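(* The following procedure correctly decides availability of a 2-pair unicast network $\mathcal{N}$ with sources $s_1,s_2$ and sinks $t_1,t_2$. That is: (1) If $C(s_1,t_1)\cdot C(s_2,t_2)=0$, then $\mathcal{N}$ is unavailable. If $C(s_1,t_1)\cdot C(s_2,t_2)>1$, then $\mathcal{N}$ is available. (2) If $C(s_1,t_1)\cdot C(s_2,t_2)=1$ and $\mathcal{A}_{1,1}\cap\mathcal{A}_{2,2}=\emptyset$, then $\mathcal{N}$ is available. (3) If $C(s_1,t_1)\cdot C(s_2,t_2)=1$ and $\mathcal{A}:=\mathcal{A}_{1,1}\cap\mathcal{A}_{2,2}\neq\emptyset$, let $\mathcal{N}'=\mathcal{N}\setminus\mathcal{A}$ be the network obtained from $\mathcal{N}$ by deleting the edges in $\mathcal{A}$. If $C_{\mathcal{N}'}(s_1,t_2)\cdot C_{\mathcal{N}'}(s_2,t_1)=0$, then $\mathcal{N}$ is unavailable; if $C_{\mathcal{N}'}(s_1,t_2)\cdot C_{\mathcal{N}'}(s_2,t_1)\neq 0$, then $\mathcal{N}$ is available.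
   Context: Networks. A 2-pair unicast network consists of a finite directed acyclic graph $G=(V,E)$ with distinct nodes $s_1,s_2$ (sources) and $t_1,t_2$ (sinks), together with edge capacities. Each $s_i$ has exactly one out-edge $S(i)$ and no in-edge; each $t_i$ has exactly one in-edge $T(i)$ and no out-edge; every other node has at least one in-edge and one out-edge. The edges $S(i),T(i)$ are auxiliary edges attached to the original source $\hat s_i=head(S(i))$ and original sink $\hat t_i=tail(T(i))$, where $\hat s_i\ne\hat t_i$ and no edge joins some $s_i$ directly to some $t_j$. The edges $S(i)$ and $T(i)$ both have capacity equal to the maximum number of edge-disjoint paths from $\hat s_i$ to $\hat t_i$ (so that this number equals $C(s_i,t_i)$ defined below); all other edges have capacity $1$. An edge $e$ goes from $tail(e)$ to $head(e)$. Cuts and $\mathcal{A}$-sets. For nodes $s,t$, an $s$-$t$ cut is the set of all edges from $A$ to $V\setminus A$, for some $A\subseteq V$ with $s\in A$, $t\notin A$; its capacity is the sum of the capacities of its edges. $C(s,t)$ (or $C_{\mathcal{N}}(s,t)$, to indicate the network) is the minimum capacity of an $s$-$t$ cut, and a minimum cut is a cut attaining it. $\mathcal{A}_{i,j}$ is the union of all minimum $s_i$-$t_j$ cuts in $\mathcal{N}$. Network coding. A network code consists of independent discrete random variables $X_1,X_2$ (the messages) with $H(X_1)=H(X_2)=1$ (entropy with respect to some chosen logarithm base) and functions $\{f_e: e\in E\}$ such that $X_{S(i)}=X_i$ for $i=1,2$, and $X_e=f_e\big((X_{e'})_{e'\in In(e)}\big)$ for every other edge $e$, where $In(e)=\{e':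 head(e')=tail(e)\}$, and such that $H(X_e)\le c(e)$ for each edge $e$, where $c(e)$ is the capacity. It is a network coding solution if $H(X_{S(i)}\mid X_{T(i)})=0$ for $i=1,2$. The network is available if a network coding solution exists, and unavailable otherwise. *)

theory Defs
  imports "Graph_Theory.Arc_Walk" "HOL-Probability.Probability"
begin

section \<open>Cuts\<close>

definition cuts :: "('v, 'e) pre_digraph \<Rightarrow> 'v \<Rightarrow> 'v \<Rightarrow> 'e set set" where
  "cuts G s t =
     {{e \<in> arcs G. tail G e \<in> A \<and> head G e \<in> verts G - A} | A. A \<subseteq> verts G \<and> s \<in> A \<and> t \<notin> A}"

definition min_cut_capacity :: "('v, 'e) pre_digraph \<Rightarrow> ('e \<Rightarrow> nat) \<Rightarrow> 'v \<Rightarrow> 'v \<Rightarrow> nat" where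
  "min_cut_capacity G c s t = Min ((\<lambda>K. \<Sum>e\<in>K. c e) ` cuts G s t)"

definition min_cuts :: "('v, 'e) pre_digraph \<Rightarrow> ('e \<Rightarrow> nat) \<Rightarrow> 'v \<Rightarrow> 'v \<Rightarrow> 'e set set" where
  "min_cuts G c s t = {K \<in> cuts G s t. (\<Sum>e\<in>K. c e) = min_cut_capacity G c s t}"

definition cut_arcs :: "('v, 'e) pre_digraph \<Rightarrow> ('e \<Rightarrow> nat) \<Rightarrow> 'v \<Rightarrow> 'v \<Rightarrow> 'e set" where
  "cut_arcs G c s t = \<Union> (min_cuts G c s t)"

definition del_arcs :: "('v, 'e) pre_digraph \<Rightarrow> 'e set \<Rightarrow> ('v, 'e) pre_digraph" where
  "del_arcs G K = G\<lparr>arcs := arcs G - K\<rparr>"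


section \<open>2-pair unicast networks\<close>

text \<open>
  The maximum is over nonempty paths if \<open>u \<noteq> v\<close>; for \<open>u = v\<close> the empty path would count
  as one path, a case that does not arise below.
\<close>

definition max_edge_disjoint_paths :: "('v, 'e) pre_digraph \<Rightarrow> 'v \<Rightarrow> 'v \<Rightarrow> nat" where
  "max_edge_disjoint_paths G u v =
     Max {card P | P. (\<forall>p\<in>P. pre_digraph.apath G u p v) \<and>
                      (\<forall>p\<in>P. \<forall>q\<in>P. p \<noteq> q \<longrightarrow> set p \<inter> set q = {})}"

text \<open>
  The two pairs are indexed by \<open>i \<in> {1, 2}\<close>; the values of \<open>s\<close>, \<open>t\<close>, \<open>S\<close>, \<open>T\<close> at other
  indices and of \<open>c\<close> outside \<open>arcs G\<close> are irrelevant. Parallel arcs are allowed.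
\<close>

locale two_pair_unicast_network = fin_digraph G
  for G :: "('v, 'e) pre_digraph" +
  fixes s t :: "nat \<Rightarrow> 'v" and S T :: "nat \<Rightarrow> 'e" and c :: "'e \<Rightarrow> nat"
  assumes no_cycle: "\<nexists>p. cycle p"
    and terminals_in_verts: "{s 1, s 2, t 1, t 2} \<subseteq> verts G"
    and terminals_distinct: "distinct [s 1, s 2, t 1, t 2]"
    and source_arcs: "i \<in> {1, 2} \<Longrightarrow> out_arcs G (s i) = {S i} \<and> in_arcs G (s i) = {}"
    and sink_arcs: "i \<in> {1, 2} \<Longrightarrow> in_arcs G (t i) = {T i} \<and> out_arcs G (t i) = {}"
    and inner_arcs: "v \<in> verts G - {s 1, s 2, t 1, t 2} \<Longrightarrow> in_arcs G v \<noteq> {} \<and> out_arcs G v \<noteq> {}"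
    and original_terminals_neq: "i \<in> {1, 2} \<Longrightarrow> head G (S i) \<noteq> tail G (T i)"
    and no_direct_arc: "\<lbrakk>i \<in> {1, 2}; j \<in> {1, 2}; e \<in> arcs G\<rbrakk> \<Longrightarrow> \<not> (tail G e = s i \<and> head G e = t j)"
    and capacity_source: "i \<in> {1, 2} \<Longrightarrow>
          c (S i) = max_edge_disjoint_paths G (head G (S i)) (tail G (T i))"
    and capacity_sink: "i \<in> {1, 2} \<Longrightarrow>
          c (T i) = max_edge_disjoint_paths G (head G (S i)) (tail G (T i))"
    and capacity_inner: "e \<in> arcs G - {S 1, S 2, T 1, T 2} \<Longrightarrow> c e = 1"


section \<open>Network coding\<close>

text \<open>
  Since all variables are discrete and only their joint distribution matters, it is no loss of
  generality to take \<open>nat\<close> both as the alphabet and as the (discrete) sample space.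
  \<open>M i\<close> is the \<open>i\<close>-th message, \<open>X e\<close> the variable carried by the arc \<open>e\<close>, and \<open>b\<close> the base of
  the logarithm.

  The library's entropy of a variable is 0 when the defining sum diverges. This cannot
  happen here: \<open>M 1\<close> and \<open>M 2\<close> have entropy 1, so the sum converges for them, and hence also
  for every \<open>X e\<close>, which is a function of the two messages.
\<close>

definition network_code ::
  "('v, 'e) pre_digraph \<Rightarrow> (nat \<Rightarrow> 'e) \<Rightarrow> ('e \<Rightarrow> nat) \<Rightarrow> real \<Rightarrow> nat pmf \<Rightarrow>
   (nat \<Rightarrow> nat \<Rightarrow> nat) \<Rightarrow> ('e \<Rightarrow> ('e \<Rightarrow> nat) \<Rightarrow> nat) \<Rightarrow> ('e \<Rightarrow> nat \<Rightarrow> nat) \<Rightarrow> bool" where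
  "network_code G S c b \<Omega> M f X \<longleftrightarrow>
     1 < b \<and>
     prob_space.indep_var (measure_pmf \<Omega>) (count_space UNIV) (M 1) (count_space UNIV) (M 2) \<and>
     (\<forall>i\<in>{1, 2}. prob_space.entropy (measure_pmf \<Omega>) b (count_space UNIV) (M i) = 1) \<and>
     (\<forall>i\<in>{1, 2}. X (S i) = M i) \<and>
     (\<forall>e \<in> arcs G - {S 1, S 2}. \<forall>\<omega>.
        X e \<omega> = f e (restrict (\<lambda>e'. X e' \<omega>) (in_arcs G (tail G e)))) \<and>
     (\<forall>e \<in> arcs G. prob_space.entropy (measure_pmf \<Omega>) b (count_space UNIV) (X e) \<le> real (c e))"

definition network_coding_solution ::
  "('v, 'e) pre_digraph \<Rightarrow> (nat \<Rightarrow> 'e) \<Rightarrow> (nat \<Rightarrow> 'e) \<Rightarrow> ('e \<Rightarrow> nat) \<Rightarrow> real \<Rightarrow> nat pmf \<Rightarrow>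
   (nat \<Rightarrow> nat \<Rightarrow> nat) \<Rightarrow> ('e \<Rightarrow> ('e \<Rightarrow> nat) \<Rightarrow> nat) \<Rightarrow> ('e \<Rightarrow> nat \<Rightarrow> nat) \<Rightarrow> bool" where
  "network_coding_solution G S T c b \<Omega> M f X \<longleftrightarrow>
     network_code G S c b \<Omega> M f X \<and>
     (\<forall>i\<in>{1, 2}. prob_space.conditional_entropy (measure_pmf \<Omega>) b
        (count_space UNIV) (count_space UNIV) (X (S i)) (X (T i)) = 0)"

definition available ::
  "('v, 'e) pre_digraph \<Rightarrow> (nat \<Rightarrow> 'e) \<Rightarrow> (nat \<Rightarrow> 'e) \<Rightarrow> ('e \<Rightarrow> nat) \<Rightarrow> bool" where
  "available G S T c \<longleftrightarrow> (\<exists>b \<Omega> M f X. network_coding_solution G S T c b \<Omega> M f X)"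

end

(*
  Idea. Call an arc a bottleneck if it lies on all s1-t1 paths, on all s2-t2 paths, and on all
  s1-t2 paths or on all s2-t1 paths.

  A bottleneck e of capacity 1 makes the network unavailable. Say it lies on all s1-t2 paths. Then
  X_e determines X_T(2), hence almost surely X_2; and X_e together with X_2 determines X_T(1),
  hence X_1. So H(X_e) = H(X_1, X_2) = 2 > 1.

  Without bottleneck there is a scalar linear code over a large prime field. Label every arc by
  the earliest arc that dominates it from both sources (its root); a root other than S(1), S(2) has
  in-arcs with two different labels, so from two independent symbols it may form any symbol. Let u
  and w be the roots of T(1) and T(2). They differ, and u is not S(2), w is not S(1); say u does
  not lie downstream of w. Let u send X_1 again, w send X_2 again, and every other root a new
  combination X_1 + n X_2. This can fail only at w, if all symbols reaching it equal X_1, that is,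
  if every path from s2 to w runs through u; but then u is a bottleneck.

  If both min-cuts are 1, the arcs on all s1-t1 and all s2-t2 paths form the set A. The first of
  them in topological order lies on all s1-t2 paths as soon as every s1-t2 path meets A, because
  an s1-t2 path that avoids it and meets A later could be continued to t1. If a min-cut is at least
  2, two edge-disjoint paths show that only S(i), T(i) lie on all paths of that pair, so there is
  no bottleneck.
*)
theory Submission
  imports Defs "HOL-Number_Theory.Cong"
begin

section \<open>Reachability avoiding a set of arcs, and cuts\<close>

context pre_digraph
begin

text \<open>Path conditions are phrased through this relation: an arc \<open>e\<close> lies on every
  path from \<open>u\<close> to \<open>v\<close> exactly if
  \<open>\<not> avoiding_reachable {e} u v\<close>.\<close>

definition avoiding_reachable :: "'b set \<Rightarrow> 'a \<Rightarrow> 'a \<Rightarrow> bool" where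
  "avoiding_reachable B u v \<longleftrightarrow> (u, v) \<in> {(tail G e, head G e) | e. e \<in> arcs G - B}\<^sup>*"

text \<open>The line graph of \<open>G\<close>. Its transitive closure is the topological order of
  the arcs, along which labels and codes are computed.\<close>

definition line_rel :: "('b \<times> 'b) set" where
  "line_rel = {(e, f). e \<in> arcs G \<and> f \<in> arcs G \<and> head G e = tail G f}"

lemma avoiding_reachable_refl [simp]: "avoiding_reachable B u u"
  by (simp add: avoiding_reachable_def)

lemma avoiding_reachable_trans:
  "avoiding_reachable B u v \<Longrightarrow> avoiding_reachable B v w \<Longrightarrow> avoiding_reachable B u w"
  unfolding avoiding_reachable_def by (rule rtrancl_trans)

lemma avoiding_reachable_arc:
  "e \<in> arcs G \<Longrightarrow> e \<notin> B \<Longrightarrow> avoiding_reachable B (tail G e) (head G e)"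
  unfolding avoiding_reachable_def by (rule r_into_rtrancl) blast

lemma avoiding_reachable_step:
  "avoiding_reachable B u (tail G e) \<Longrightarrow> e \<in> arcs G \<Longrightarrow> e \<notin> B \<Longrightarrow> avoiding_reachable B u (head G e)"
  by (blast intro: avoiding_reachable_trans avoiding_reachable_arc)

lemma avoiding_reachable_induct [consumes 1, case_names base step]:
  assumes "avoiding_reachable B u v"
    and "P u"
    and "\<And>e. avoiding_reachable B u (tail G e) \<Longrightarrow> P (tail G e) \<Longrightarrow> e \<in> arcs G \<Longrightarrow> e \<notin> B \<Longrightarrow> P (head G e)"
  shows "P v"
  using assms(1) unfolding avoiding_reachable_def
  by (induction rule: rtrancl_induct) (use assms(2,3) in \<open>auto simp: avoiding_reachable_def\<close>)

lemma avoiding_reachable_converse_induct [consumes 1, case_names base step]: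
  assumes "avoiding_reachable B u v"
    and "P v"
    and "\<And>e. avoiding_reachable B (head G e) v \<Longrightarrow> P (head G e) \<Longrightarrow> e \<in> arcs G \<Longrightarrow> e \<notin> B \<Longrightarrow> P (tail G e)"
  shows "P u"
  using assms(1) unfolding avoiding_reachable_def
  by (induction rule: converse_rtrancl_induct) (use assms(2,3) in \<open>auto simp: avoiding_reachable_def\<close>)

lemma avoiding_reachable_cases:
  assumes "avoiding_reachable B u v"
  obtains "u = v"
  | e where "e \<in> arcs G" "e \<notin> B" "head G e = v" "avoiding_reachable B u (tail G e)"
  using assms unfolding avoiding_reachable_def
  by (cases rule: rtranclE) blast+

lemma avoiding_reachable_mono:
  assumes "avoiding_reachable B u v" "B' \<subseteq> B"
  shows "avoiding_reachable B' u v"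
  using assms(1) by (induction rule: avoiding_reachable_induct)
    (use assms(2) in \<open>auto intro: avoiding_reachable_step\<close>)

text \<open>Follow a \<open>B\<close>-avoiding path from its start: if it cannot be made to avoid
  \<open>A\<close> as well, it meets some arc of \<open>A\<close>, and its part before that arc is
  the path asked for.\<close>

lemma avoiding_reachable_hits_tail:
  assumes "avoiding_reachable B u v" "\<not> avoiding_reachable (B \<union> A) u v"
  obtains a where "a \<in> A" "a \<in> arcs G" "a \<notin> B" "avoiding_reachable B u (tail G a)"
proof -
  have "avoiding_reachable (B \<union> A) u v \<or>
    (\<exists>a\<in>A. a \<in> arcs G \<and> a \<notin> B \<and> avoiding_reachable B u (tail G a))"
    using assms(1) by (induction rule: avoiding_reachable_induct)
      (auto intro: avoiding_reachable_step)
  then show ?thesis using assms(2) that by blast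
qed

text \<open>The counterpart for the end of the path: what follows a use of \<open>a\<close> leads
  from \<open>head G a\<close> to \<open>v\<close>.\<close>

lemma avoiding_reachable_hits_head:
  assumes "avoiding_reachable B u v" "\<not> avoiding_reachable (insert a B) u v"
  shows "avoiding_reachable B (head G a) v"
proof -
  have "avoiding_reachable (insert a B) u v \<or> avoiding_reachable B (head G a) v"
    using assms(1) 
  proof (induction rule: avoiding_reachable_converse_induct)
    case (step e)
    then show ?case
      by (cases "e = a") (auto intro: avoiding_reachable_trans[OF avoiding_reachable_arc])
  qed simp
  then show ?thesis using assms(2) by blast
qed

lemma avoiding_reachable_line_rel:
  assumes "avoiding_reachable B (head G a) v" "a \<in> arcs G"
  shows "\<forall>e\<in>arcs G. tail G e = v \<longrightarrow> (a, e) \<in> line_rel\<^sup>+"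
  using assms(1)
proof (induction rule: avoiding_reachable_induct)
  case base
  then show ?case using assms(2) by (auto simp: line_rel_def)
next
  case (step e)
  then have "(a, e) \<in> line_rel\<^sup>+" by blast
  moreover have "(e, f) \<in> line_rel" if "f \<in> arcs G" "tail G f = head G e" for f
    using that step.hyps by (auto simp: line_rel_def)
  ultimately show ?case by (blast intro: trancl_into_trancl)
qed

end

lemma (in wf_digraph) awalk_avoiding_reachable:
  "awalk u p v \<Longrightarrow> set p \<inter> B = {} \<Longrightarrow> avoiding_reachable B u v"
proof (induction p arbitrary: u)
  case Nil
  then show ?case by (simp add: awalk_Nil_iff)
next
  case (Cons e p)
  then have "avoiding_reachable B (head G e) v" "e \<in> arcs G" "tail G e = u" "e \<notin> B"
    by (auto simp: awalk_Cons_iff)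
  then show ?case using avoiding_reachable_arc avoiding_reachable_trans by metis
qed

lemma (in wf_digraph) line_rel_trancl_awalk:
  "(e, f) \<in> line_rel\<^sup>+ \<Longrightarrow> \<exists>p. p \<noteq> [] \<and> awalk (tail G e) p (tail G f)"
proof (induction rule: trancl_induct)
  case (base f)
  then show ?case
    by (intro exI[of _ "[e]"]) (auto simp: line_rel_def awalk_Cons_iff awalk_Nil_iff)
next
  case (step f g)
  then obtain p where "p \<noteq> []" "awalk (tail G e) p (tail G f)" by blast
  moreover have "awalk (tail G f) [f] (tail G g)"
    using step.hyps by (auto simp: line_rel_def awalk_Cons_iff awalk_Nil_iff)
  ultimately show ?case by (intro exI[of _ "p @ [f]"]) auto
qed

section \<open>Well-foundedness of the line graph; minimum cuts in terms of avoiding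
  reachability\<close>

context fin_digraph
begin

text \<open>A cycle of the line graph traces out a closed walk of \<open>G\<close>, and a closed
  walk contains a cycle.\<close>

lemma wf_line_rel:
  assumes "\<nexists>p. cycle p"
  shows "wf line_rel"
proof (rule finite_acyclic_wf)
  have "line_rel \<subseteq> arcs G \<times> arcs G" by (auto simp: line_rel_def)
  then show "finite line_rel" by (rule finite_subset) simp
  show "acyclic line_rel"
  proof (rule acyclicI, intro allI notI)
    fix e assume "(e, e) \<in> line_rel\<^sup>+"
    then obtain p where "p \<noteq> []" "awalk (tail G e) p (tail G e)"
      using line_rel_trancl_awalk by blast
    then have "closed_w p" by (auto simp: closed_w_def)
    then show False using assms closed_w_imp_cycle by blast
  qed
qed

lemma finite_cuts: "finite (cuts G u v)"
  by (rule finite_subset[of _ "Pow (arcs G)"]) (auto simp: cuts_def)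

lemma finite_cut: "K \<in> cuts G u v \<Longrightarrow> finite K"
  by (auto simp: cuts_def intro: finite_subset[OF _ finite_arcs])

lemma min_cut_capacity_le: "K \<in> cuts G u v \<Longrightarrow> min_cut_capacity G c u v \<le> sum c K"
  unfolding min_cut_capacity_def using finite_cuts by (intro Min_le) auto

lemma cut_of_vertex:
  "u \<in> verts G \<Longrightarrow> u \<noteq> v \<Longrightarrow> {e \<in> arcs G. tail G e = u \<and> head G e \<noteq> u} \<in> cuts G u v"
  unfolding cuts_def by (rule CollectI, rule exI[of _ "{u}"]) auto

lemma min_cut_exists:
  assumes "u \<in> verts G" "u \<noteq> v"
  obtains K where "K \<in> cuts G u v" "sum c K = min_cut_capacity G c u v"
proof -
  have "min_cut_capacity G c u v \<in> (\<lambda>K. sum c K) ` cuts G u v"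
    unfolding min_cut_capacity_def using finite_cuts cut_of_vertex[OF assms] by (intro Min_in) auto
  then show ?thesis using that by (metis imageE)
qed

lemma cut_not_avoidable:
  assumes "K \<in> cuts G u v"
  shows "\<not> avoiding_reachable K u v"
proof
  obtain A where A: "K = {e \<in> arcs G. tail G e \<in> A \<and> head G e \<in> verts G - A}" "u \<in> A" "v \<notin> A"
    using assms by (auto simp: cuts_def)
  assume "avoiding_reachable K u v"
  then have "v \<in> A" using A(1,2) by (induction rule: avoiding_reachable_induct) auto
  then show False using A(3) by simp
qed

text \<open>Take the cut around the nodes reachable from \<open>u\<close> without \<open>B\<close>:
  an arc leaving this set outside \<open>B\<close> would enlarge it.\<close>

lemma unavoidable_contains_cut:
  assumes "\<not> avoiding_reachable B u v" "u \<in> verts G"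
  obtains K where "K \<in> cuts G u v" "K \<subseteq> B"
proof -
  define A where "A = {w \<in> verts G. avoiding_reachable B u w}"
  have "{e \<in> arcs G. tail G e \<in> A \<and> head G e \<in> verts G - A} \<in> cuts G u v"
    unfolding cuts_def by (rule CollectI, rule exI[of _ A]) (use assms in \<open>auto simp: A_def\<close>)
  moreover have "{e \<in> arcs G. tail G e \<in> A \<and> head G e \<in> verts G - A} \<subseteq> B"
    by (auto simp: A_def intro: avoiding_reachable_step)
  ultimately show ?thesis using that by blast
qed

lemma unavoidable_arc_in_cut_arcs:
  assumes "\<not> avoiding_reachable {e} u v" "u \<in> verts G" "min_cut_capacity G c u v = 1" "c e = 1"
  shows "e \<in> cut_arcs G c u v"
proof -
  obtain K where K: "K \<in> cuts G u v" "K \<subseteq> {e}"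
    using unavoidable_contains_cut assms(1,2) by metis
  have "sum c K \<ge> 1" using min_cut_capacity_le[OF K(1), of c] assms(3) by simp
  then have "K = {e}" using K(2) by (cases "K = {}") auto
  then show ?thesis using K(1) assms(3,4)
    unfolding cut_arcs_def min_cuts_def by (intro UnionI[of K]) auto
qed

text \<open>As all capacities are positive, a minimum cut of capacity 1 is a single arc. With
  \<open>unavoidable_arc_in_cut_arcs\<close>, this identifies the union of the minimum cuts with the
  arcs of capacity 1 that lie on all paths.\<close>

lemma cut_arcs_unavoidable:
  assumes "e \<in> cut_arcs G c u v" "min_cut_capacity G c u v = 1" "\<And>f. f \<in> arcs G \<Longrightarrow> c f \<ge> 1"
  shows "e \<in> arcs G" "c e = 1" "\<not> avoiding_reachable {e} u v"
proof -
  obtain K where K: "K \<in> cuts G u v" "sum c K = 1" "e \<in> K"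
    using assms(1,2) by (auto simp: cut_arcs_def min_cuts_def)
  have fin: "finite K" and sub: "K \<subseteq> arcs G" using K(1) finite_cut by (auto simp: cuts_def)
  have s: "sum c K = c e + sum c (K - {e})" using fin K(3) by (rule sum.remove)
  have ce: "c e \<ge> 1" using assms(3) K(3) sub by auto
  then have "sum c (K - {e}) = 0" using s K(2) by linarith
  then have "\<forall>f\<in>K - {e}. c f = 0" using fin by simp
  then have "f \<notin> K - {e}" for f using assms(3)[of f] sub by force
  then have "K = {e}" using K(3) by blast
  then show "\<not> avoiding_reachable {e} u v" using cut_not_avoidable[OF K(1)] by simp
  show "e \<in> arcs G" using K(3) sub by blast
  show "c e = 1" using s ce K(2) by linarith
qed

lemma fin_digraph_del_arcs: "fin_digraph (del_arcs G A)"
  by (unfold_locales) (auto simp: del_arcs_def)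

lemma avoiding_reachable_del_arcs:
  "pre_digraph.avoiding_reachable (del_arcs G A) B u v \<longleftrightarrow> avoiding_reachable (A \<union> B) u v"
  unfolding pre_digraph.avoiding_reachable_def del_arcs_def by (simp add: set_diff_eq conj_ac)

lemma min_cut_capacity_pos_reachable:
  assumes "min_cut_capacity G c u v \<noteq> 0" "u \<in> verts G"
  shows "avoiding_reachable {} u v"
proof (rule ccontr)
  assume "\<not> avoiding_reachable {} u v"
  then obtain K where "K \<in> cuts G u v" "K \<subseteq> {}" using unavoidable_contains_cut assms(2) by metis
  then show False using min_cut_capacity_le[of K u v c] assms(1) by simp
qed

text \<open>With positive capacities, a cut of capacity 0 is empty.\<close>

lemma min_cut_capacity_zero_unreachable:
  assumes "min_cut_capacity G c u v = 0" "u \<in> verts G" "u \<noteq> v" "\<And>f. f \<in> arcs G \<Longrightarrow> c f \<ge> 1"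
  shows "\<not> avoiding_reachable {} u v"
proof -
  obtain K where K: "K \<in> cuts G u v" "sum c K = 0"
    using min_cut_exists[OF assms(2,3), of c] assms(1) by metis
  have "K \<subseteq> arcs G" using K(1) by (auto simp: cuts_def)
  moreover have "\<forall>f\<in>K. c f = 0" using K finite_cut by auto
  ultimately have "K = {}" using assms(4) by fastforce
  then show ?thesis using cut_not_avoidable[OF K(1)] by simp
qed

lemma max_edge_disjoint_paths_witness:
  obtains P where "card P = max_edge_disjoint_paths G u v" "\<forall>p\<in>P. apath u p v"
    "\<forall>p\<in>P. \<forall>q\<in>P. p \<noteq> q \<longrightarrow> set p \<inter> set q = {}"
proof -
  let ?S = "{card P | P. (\<forall>p\<in>P. apath u p v) \<and> (\<forall>p\<in>P. \<forall>q\<in>P. p \<noteq> q \<longrightarrow> set p \<inter> set q = {})}"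
  have "?S \<subseteq> card ` Pow {p. apath u p v}" by auto
  then have "finite ?S" by (rule finite_subset) (simp add: apaths_finite)
  moreover have "card {} \<in> ?S" by (rule CollectI, rule exI[of _ "{}"]) simp
  ultimately have "Max ?S \<in> ?S" by (intro Max_in) auto
  then show ?thesis using that unfolding max_edge_disjoint_paths_def by auto
qed

end

section \<open>Entropy of discrete random variables\<close>

lemma pmf_map_apply_pos: "w \<in> set_pmf p \<Longrightarrow> pmf (map_pmf X p) (X w) > 0"
  by (simp add: pmf_positive)

text \<open>If on the support the value of \<open>X\<close> at \<open>w\<close> forces that of
  \<open>Y\<close>, the event \<open>X = X w\<close> is almost surely contained in
  \<open>Y = Y w\<close>.\<close>

lemma pmf_map_mono:
  assumes "\<And>w'. w' \<in> set_pmf p \<Longrightarrow> X w' = X w \<Longrightarrow> Y w' = Y w"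
  shows "pmf (map_pmf X p) (X w) \<le> pmf (map_pmf Y p) (Y w)"
  unfolding pmf_map
  by (rule measure_pmf.finite_measure_mono_AE) (use assms in \<open>auto simp: AE_measure_pmf_iff\<close>)

lemma distributed_map_pmf:
  "distributed (measure_pmf p) (count_space UNIV) X (\<lambda>x. ennreal (pmf (map_pmf X p) x))"
  unfolding distributed_def
  by (auto simp: map_pmf_rep_eq[symmetric] measure_pmf_eq_density[symmetric])

lemma integral_pmf_map:
  fixes f :: "'b \<Rightarrow> real"
  shows "(\<integral>x. pmf (map_pmf X p) x * f x \<partial>count_space UNIV) = measure_pmf.expectation p (\<lambda>w. f (X w))"
proof -
  have "(\<integral>x. pmf (map_pmf X p) x * f x \<partial>count_space UNIV) = measure_pmf.expectation (map_pmf X p) f"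
    by (subst measure_pmf_eq_density) (simp add: integral_density)
  then show ?thesis by simp
qed

text \<open>Both sides are Bochner integrals, which are 0 for a non-integrable integrand, so the
  identity is unconditional; integrability has to be established separately wherever it
  matters.\<close>

lemma entropy_pmf:
  fixes X :: "'a \<Rightarrow> 'b :: countable"
  assumes "1 < b"
  shows "prob_space.entropy (measure_pmf p) b (count_space UNIV) X =
    - measure_pmf.expectation p (\<lambda>w. log b (pmf (map_pmf X p) (X w)))"
proof -
  interpret information_space "measure_pmf p" b
    by unfold_locales (rule assms)
  show ?thesis
    by (subst entropy_distr[OF distributed_map_pmf]) (simp_all add: integral_pmf_map)
qed

lemma conditional_entropy_pmf:
  fixes X :: "'a \<Rightarrow> 'b :: countable" and Y :: "'a \<Rightarrow> 'c :: countable"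
  assumes "1 < b"
  shows "prob_space.conditional_entropy (measure_pmf p) b (count_space UNIV) (count_space UNIV) X Y =
    - measure_pmf.expectation p (\<lambda>w. log b (pmf (map_pmf (\<lambda>w. (X w, Y w)) p) (X w, Y w) /
        pmf (map_pmf Y p) (Y w)))"
proof -
  interpret information_space "measure_pmf p" b
    by unfold_locales (rule assms)
  have c: "count_space UNIV \<Otimes>\<^sub>M count_space UNIV = (count_space UNIV :: ('b \<times> 'c) measure)"
    by (simp add: pair_measure_countable)
  show ?thesis
    by (subst conditional_entropy_generic_eq[OF _ _ distributed_map_pmf _ 
        distributed_map_pmf[of p "\<lambda>w. (X w, Y w)", folded c]])
      (simp_all add: c sigma_finite_measure_count_space split_beta' integral_pmf_map[where X="\<lambda>w. (X w, Y w)"])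
qed

lemma entropy_pmf_le_log_card:
  fixes X :: "'a \<Rightarrow> 'b :: countable"
  assumes "1 < b" "finite A" "\<And>w. X w \<in> A"
  shows "prob_space.entropy (measure_pmf p) b (count_space UNIV) X \<le> log b (real (card A))"
proof -
  interpret information_space "measure_pmf p" b
    by unfold_locales (rule assms)
  let ?q = "pmf (map_pmf X p)"
  have zero: "?q x = 0" if "x \<notin> A" for x
    using that assms(3) by (auto simp: pmf_eq_0_set_pmf)
  have sub: "{x. ?q x \<noteq> 0} \<subseteq> A" using zero by blast
  have fin: "finite {x. ?q x \<noteq> 0}" using sub assms(2) by (rule finite_subset)
  obtain w where "w \<in> set_pmf p" using set_pmf_not_empty[of p] by blast
  then have "?q (X w) \<noteq> 0" by (simp add: pmf_eq_0_set_pmf)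
  then have ne: "{x. ?q x \<noteq> 0} \<noteq> {}" by blast
  have "finite (set_pmf (map_pmf X p))" using fin by (simp add: set_pmf_eq)
  then have "integrable (measure_pmf (map_pmf X p)) (\<lambda>x. log b (?q x))"
    by (rule integrable_measure_pmf_finite)
  then have "integrable (count_space UNIV) (\<lambda>x. ?q x * log b (?q x))"
    by (subst (asm) measure_pmf_eq_density) (simp add: integrable_real_density)
  then have "integrable (count_space UNIV) (\<lambda>x. - ?q x * log b (?q x))" by simp
  then have "prob_space.entropy (measure_pmf p) b (count_space UNIV) X
      \<le> log b (measure (count_space UNIV) {x \<in> space (count_space UNIV). ?q x \<noteq> 0})"
    using fin by (intro entropy_le distributed_map_pmf) auto
  also have "\<dots> = log b (real (card {x. ?q x \<noteq> 0}))"
    using fin by (simp add: measure_count_space)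
  also have "\<dots> \<le> log b (real (card A))"
  proof -
    have "0 < card {x. ?q x \<noteq> 0}" unfolding card_gt_0_iff using ne fin by blast
    then show ?thesis using assms(1) card_mono[OF assms(2) sub] by simp
  qed
  finally show ?thesis .
qed

lemma indep_var_pmf_map_pair:
  fixes X Y :: "'a \<Rightarrow> 'b"
  assumes "prob_space.indep_var (measure_pmf p) (count_space UNIV) X (count_space UNIV) Y"
  shows "pmf (map_pmf (\<lambda>w. (X w, Y w)) p) (x, y) = pmf (map_pmf X p) x * pmf (map_pmf Y p) y"
proof -
  have "measure (measure_pmf p) ((\<lambda>w. (X w, Y w)) -` ({x} \<times> {y}) \<inter> space (measure_pmf p)) =
      measure (measure_pmf p) (X -` {x} \<inter> space (measure_pmf p)) *
      measure (measure_pmf p) (Y -` {y} \<inter> space (measure_pmf p))"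
    using assms by (rule prob_space.indep_varD[OF prob_space_measure_pmf]) auto
  then show ?thesis by (simp add: pmf_map)
qed

text \<open>Independence means that the joint law is the product of the marginal laws; on a
  countable discrete space it suffices to compare the two on points.\<close>

lemma indep_var_if_pmf_map_pair:
  fixes X Y :: "'a \<Rightarrow> 'b :: countable"
  assumes "map_pmf (\<lambda>w. (X w, Y w)) p = pair_pmf (map_pmf X p) (map_pmf Y p)"
  shows "prob_space.indep_var (measure_pmf p) (count_space UNIV) X (count_space UNIV) Y"
proof -
  let ?C = "count_space UNIV :: 'b measure"
  have c: "?C \<Otimes>\<^sub>M ?C = count_space UNIV"
    by (simp add: pair_measure_countable)
  have "measure_pmf (map_pmf X p) \<Otimes>\<^sub>M measure_pmf (map_pmf Y p) =
      measure_pmf (pair_pmf (map_pmf X p) (map_pmf Y p))" (is "?L = ?R")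
  proof (rule measure_eqI_countable[where A = UNIV])
    have "sets ?L = sets (?C \<Otimes>\<^sub>M ?C)" by (rule sets_pair_measure_cong) auto
    then show "sets ?L = Pow UNIV" unfolding c by (simp only: sets_count_space)
    show "sets ?R = Pow UNIV" by simp
    show "emeasure ?L {a} = emeasure ?R {a}" for a
    proof -
      have pair: "{fst a} \<times> {snd a} = {a}" by (cases a) auto
      have "emeasure ?L ({fst a} \<times> {snd a}) = emeasure (measure_pmf (map_pmf X p)) {fst a} *
          emeasure (measure_pmf (map_pmf Y p)) {snd a}"
        by (rule sigma_finite_measure.emeasure_pair_measure_Times)
          (simp_all add: prob_space_imp_sigma_finite prob_space_measure_pmf)
      also have "\<dots> = ennreal (pmf (map_pmf X p) (fst a) * pmf (map_pmf Y p) (snd a))"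
        unfolding emeasure_pmf_single by (rule ennreal_mult[symmetric]) (rule pmf_nonneg)+
      also have "\<dots> = emeasure ?R {a}"
        unfolding emeasure_pmf_single by (cases a) (simp only: pmf_pair fst_conv snd_conv)
      finally show ?thesis unfolding pair .
    qed
  qed (rule countableI_type)
  then have "distr p ?C X \<Otimes>\<^sub>M distr p ?C Y = distr p (?C \<Otimes>\<^sub>M ?C) (\<lambda>w. (X w, Y w))"
    unfolding c map_pmf_rep_eq[symmetric] assms .
  moreover have "X \<in> measurable (measure_pmf p) ?C" "Y \<in> measurable (measure_pmf p) ?C"
    by simp_all
  ultimately show ?thesis
    by (intro iffD2[OF prob_space.indep_var_distribution_eq[OF prob_space_measure_pmf]] conjI)
qed

section \<open>Labellings of the line graph\<close>

context pre_digraph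
begin

text \<open>
  An arc labelled \<open>l\<close> carries the symbol that first appears on the arc \<open>l\<close>: \<open>\<sigma>\<close> prescribes some
  labels, an arc whose tail sees a single label forwards it, and an arc whose tail sees several
  labels starts a new symbol, named after itself.
\<close>

definition label_step :: "('b \<Rightarrow> 'b option) \<Rightarrow> ('b \<Rightarrow> 'b option) \<Rightarrow> 'b \<Rightarrow> 'b option" where
  "label_step \<sigma> L e = (case \<sigma> e of Some l \<Rightarrow> Some l | None \<Rightarrow>
     let Q = {l. \<exists>e'\<in>in_arcs G (tail G e). L e' = Some l}
     in if Q = {} then None else if is_singleton Q then Some (the_elem Q) else Some e)"

definition label :: "('b \<Rightarrow> 'b option) \<Rightarrow> 'b \<Rightarrow> 'b option" where
  "label \<sigma> = wfrec line_rel (label_step \<sigma>)"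

definition in_labels :: "('b \<Rightarrow> 'b option) \<Rightarrow> 'b \<Rightarrow> 'b set" where
  "in_labels \<sigma> e = {l. \<exists>e'\<in>in_arcs G (tail G e). label \<sigma> e' = Some l}"

end

section \<open>How labels spread along paths, for arbitrary prescriptions\<close>

locale line_wf_digraph = fin_digraph +
  assumes wf_line: "wf line_rel"
begin

lemma label_rec:
  assumes "e \<in> arcs G"
  shows "label \<sigma> e = (case \<sigma> e of Some l \<Rightarrow> Some l | None \<Rightarrow>
     if in_labels \<sigma> e = {} then None
     else if is_singleton (in_labels \<sigma> e) then Some (the_elem (in_labels \<sigma> e)) else Some e)"
proof -
  \<comment> \<open>The arcs entering the tail of \<open>e\<close> are predecessors of
    \<open>e\<close> in \<open>line_rel\<close>, so the truncation by \<open>cut\<close> does not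
    change their labels.\<close>
  have "{l. \<exists>e'\<in>in_arcs G (tail G e). cut (label \<sigma>) line_rel e e' = Some l} = in_labels \<sigma> e"
    using assms by (auto simp: in_labels_def cut_def line_rel_def)
  then have "label_step \<sigma> (cut (label \<sigma>) line_rel e) e = (case \<sigma> e of Some l \<Rightarrow> Some l | None \<Rightarrow>
     if in_labels \<sigma> e = {} then None
     else if is_singleton (in_labels \<sigma> e) then Some (the_elem (in_labels \<sigma> e)) else Some e)"
    by (simp only: label_step_def Let_def)
  moreover have "label \<sigma> e = label_step \<sigma> (cut (label \<sigma>) line_rel e) e"
    unfolding label_def by (rule wfrec[OF wf_line])
  ultimately show ?thesis by (rule trans[rotated])
qed

lemma label_cases [consumes 1, case_names source none copy fresh]:
  assumes "e \<in> arcs G"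
  obtains l where "\<sigma> e = Some l" "label \<sigma> e = Some l"
  | "\<sigma> e = None" "in_labels \<sigma> e = {}" "label \<sigma> e = None"
  | l where "\<sigma> e = None" "in_labels \<sigma> e = {l}" "label \<sigma> e = Some l"
  | l l' where "\<sigma> e = None" "l \<in> in_labels \<sigma> e" "l' \<in> in_labels \<sigma> e" "l \<noteq> l'" "label \<sigma> e = Some e"
proof (cases "\<sigma> e")
  case None
  consider "in_labels \<sigma> e = {}" | l where "in_labels \<sigma> e = {l}"
    | l l' where "l \<in> in_labels \<sigma> e" "l' \<in> in_labels \<sigma> e" "l \<noteq> l'"
    by blast
  then show ?thesis
  proof cases
    case 1
    then show ?thesis using None label_rec[OF assms, of \<sigma>] that(2) by simp
  next
    case (2 l)
    then show ?thesis using None label_rec[OF assms, of \<sigma>] that(3) by simp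
  next
    case (3 l l')
    then have "in_labels \<sigma> e \<noteq> {}" "\<not> is_singleton (in_labels \<sigma> e)"
      by (auto simp: is_singleton_def)
    then show ?thesis using 3 None label_rec[OF assms, of \<sigma>] that(4) by simp
  qed
next
  case (Some l)
  then show ?thesis using label_rec[OF assms, of \<sigma>] that(1) by simp
qed

lemma label_source: "e \<in> arcs G \<Longrightarrow> \<sigma> e = Some l \<Longrightarrow> label \<sigma> e = Some l"
  by (cases rule: label_cases[of e \<sigma>]) auto

lemma in_labelsI: "e' \<in> arcs G \<Longrightarrow> head G e' = tail G e \<Longrightarrow> label \<sigma> e' = Some l \<Longrightarrow> l \<in> in_labels \<sigma> e"
  by (auto simp: in_labels_def)

lemma line_induct [consumes 1, case_names step]:
  assumes "e \<in> arcs G"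
    and "\<And>e. e \<in> arcs G \<Longrightarrow> (\<And>e'. e' \<in> arcs G \<Longrightarrow> head G e' = tail G e \<Longrightarrow> P e') \<Longrightarrow> P e"
  shows "P e"
  using assms(1)
proof (induction e rule: wf_induct_rule[OF wf_line])
  case (1 e)
  show ?case
    by (rule assms(2)[OF 1(2)]) (rule 1(1), simp_all add: line_rel_def 1(2))
qed

lemma line_acyclic: "(e, e) \<notin> line_rel\<^sup>+"
  using wf_acyclic[OF wf_line] by (auto simp: acyclic_def)

lemma line_acyclic': "(e, f) \<in> line_rel\<^sup>* \<Longrightarrow> (f, e) \<in> line_rel\<^sup>+ \<Longrightarrow> False"
  using rtrancl_trancl_trancl[of e f line_rel e] line_acyclic[of e] by metis

text \<open>An arc outside the deleted set whose label, if any, is in \<open>Q\<close> neither has a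
  prescribed label nor starts a new one (that would be its own name), so every label at its tail is
  in \<open>Q\<close>. Hence the last arc of a path to it that avoids the deleted set has the same
  property. Going back in this way ends at an arc leaving \<open>x\<close>, whose label is
  prescribed: a contradiction.\<close>

lemma label_unreachable:
  assumes "e \<in> arcs G" "\<And>f. f \<in> arcs G \<Longrightarrow> tail G f = x \<Longrightarrow> \<sigma> f \<noteq> None"
    and "\<And>l. label \<sigma> e = Some l \<Longrightarrow> l \<in> Q"
    and "e \<notin> Q \<union> {f. \<exists>l\<in>Q. \<sigma> f = Some l}"
  shows "\<not> avoiding_reachable (Q \<union> {f. \<exists>l\<in>Q. \<sigma> f = Some l}) x (tail G e)"
  using assms(1,3,4)
proof (induction e rule: line_induct)
  case (step e)
  let ?B = "Q \<union> {f. \<exists>l\<in>Q. \<sigma> f = Some l}"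
  show ?case
  proof
    assume "avoiding_reachable ?B x (tail G e)"
    then consider "x = tail G e"
      | e' where "e' \<in> arcs G" "e' \<notin> ?B" "head G e' = tail G e" "avoiding_reachable ?B x (tail G e')"
      by (rule avoiding_reachable_cases)
    then show False
    proof cases
      case 1
      then obtain l where "\<sigma> e = Some l" using assms(2)[OF step.hyps] by blast
      then show False using step.prems label_source[of e \<sigma> l] step.hyps by auto
    next
      case (2 e')
      have "l \<in> Q" if l: "label \<sigma> e' = Some l" for l
        using step.hyps
      proof (cases rule: label_cases[of e \<sigma>])
        case (source l)
        then show ?thesis using step.prems by auto
      qed (use step.prems in_labelsI[OF 2(1,3) l] in auto)
      then show False using step.IH[OF 2(1,3) _ 2(2)] 2(4) by blast
    qed
  qed
qed

text \<open>Since \<open>l\<close> is prescribed nowhere but on \<open>l\<close> itself, every other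
  arc with this label has copied it from an arc before it.\<close>

lemma label_descendant:
  assumes "e \<in> arcs G" "label \<sigma> e = Some l" "\<And>f. \<sigma> f = Some l \<Longrightarrow> f = l"
  shows "(l, e) \<in> line_rel\<^sup>*"
  using assms(1,2)
proof (induction e rule: line_induct)
  case (step e)
  from step.hyps show ?case
  proof (cases rule: label_cases[of e \<sigma>])
    case (copy l')
    then have "l \<in> in_labels \<sigma> e" using step.prems by auto
    then obtain e' where e': "e' \<in> arcs G" "head G e' = tail G e" "label \<sigma> e' = Some l"
      by (auto simp: in_labels_def)
    then have "(e', e) \<in> line_rel" using step.hyps by (auto simp: line_rel_def)
    then show ?thesis using step.IH[OF e'] by (rule rtrancl_into_rtrancl[rotated])
  next
    case (source l')
    then show ?thesis using step.prems assms(3)[of e] by simp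
  qed (use step.prems in auto)
qed

lemma label_cong:
  assumes "e \<in> arcs G" "\<And>f. \<sigma> f \<noteq> \<sigma>' f \<Longrightarrow> (f, e) \<notin> line_rel\<^sup>*"
  shows "label \<sigma> e = label \<sigma>' e"
  using assms
proof (induction e rule: line_induct)
  case (step e)
  have "label \<sigma> e' = label \<sigma>' e'" if e': "e' \<in> arcs G" "head G e' = tail G e" for e'
  proof (rule step.IH[OF e'])
    fix f assume "\<sigma> f \<noteq> \<sigma>' f"
    then have "(f, e) \<notin> line_rel\<^sup>*" by (rule step.prems)
    moreover have "(e', e) \<in> line_rel" using e' step.hyps by (auto simp: line_rel_def)
    ultimately show "(f, e') \<notin> line_rel\<^sup>*" using rtrancl_into_rtrancl[of f e' line_rel e] by metis
  qed
  then have "in_labels \<sigma> e = in_labels \<sigma>' e" by (auto simp: in_labels_def)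
  moreover have "\<sigma> e = \<sigma>' e" using step.prems[of e] rtrancl.rtrancl_refl[of e line_rel] by metis
  ultimately show ?case by (simp only: label_rec[OF step.hyps])
qed

lemma in_labels_cong:
  assumes "e \<in> arcs G" "\<And>f. \<sigma> f \<noteq> \<sigma>' f \<Longrightarrow> (f, e) \<notin> line_rel\<^sup>+"
  shows "in_labels \<sigma> e = in_labels \<sigma>' e"
proof -
  have "label \<sigma> e' = label \<sigma>' e'" if e': "e' \<in> arcs G" "head G e' = tail G e" for e'
  proof (rule label_cong[OF e'(1)])
    fix f assume "\<sigma> f \<noteq> \<sigma>' f"
    then have "(f, e) \<notin> line_rel\<^sup>+" by (rule assms(2))
    moreover have "(e', e) \<in> line_rel" using e' assms(1) by (auto simp: line_rel_def)
    ultimately show "(f, e') \<notin> line_rel\<^sup>*" using rtrancl_into_trancl1[of f e' line_rel e] by metis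
  qed
  then show ?thesis by (auto simp: in_labels_def)
qed

lemma label_in_arcs:
  assumes "e \<in> arcs G" "label \<sigma> e = Some l" "\<And>f l. \<sigma> f = Some l \<Longrightarrow> l \<in> arcs G"
  shows "l \<in> arcs G"
  using assms(1,2)
proof (induction e rule: line_induct)
  case (step e)
  from step.hyps show ?case
  proof (cases rule: label_cases[of e \<sigma>])
    case (copy l')
    then have "l \<in> in_labels \<sigma> e" using step.prems by simp
    then obtain e' where "e' \<in> arcs G" "head G e' = tail G e" "label \<sigma> e' = Some l"
      by (auto simp: in_labels_def)
    then show ?thesis by (rule step.IH)
  next
    case (source l')
    then show ?thesis using step.prems assms(3)[of e l] by simp
  qed (use step in auto)
qed

text \<open>The variant of \<open>label_unreachable\<close> that constrains only the labels arriving
  at \<open>e\<close>, whatever \<open>e\<close> itself then carries.\<close>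

lemma in_labels_unreachable:
  assumes "e \<in> arcs G" "\<And>f. f \<in> arcs G \<Longrightarrow> tail G f = x \<Longrightarrow> \<sigma> f \<noteq> None"
    and "in_labels \<sigma> e \<subseteq> Q" "\<sigma> e = None"
  shows "\<not> avoiding_reachable (Q \<union> {f. \<exists>l\<in>Q. \<sigma> f = Some l}) x (tail G e)"
proof
  let ?B = "Q \<union> {f. \<exists>l\<in>Q. \<sigma> f = Some l}"
  assume "avoiding_reachable ?B x (tail G e)"
  then show False
  proof (cases rule: avoiding_reachable_cases)
    case 1
    then show False using assms(2)[OF assms(1)] assms(4) by simp
  next
    case (2 e')
    have "l \<in> Q" if "label \<sigma> e' = Some l" for l
      using in_labelsI[OF 2(1,3) that] assms(3) by blast
    then show False using label_unreachable[OF 2(1) assms(2) _ 2(2)] 2(4) by blast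
  qed
qed

end

section \<open>Roots: the labelling in which only source arcs are prescribed\<close>

locale labelled_digraph = line_wf_digraph +
  fixes Src :: "'b set"
  assumes Src_arcs: "Src \<subseteq> arcs G"
begin

definition src_label :: "'b \<Rightarrow> 'b option" where
  "src_label e = (if e \<in> Src then Some e else None)"

lemma src_label_Some: "src_label e = Some l \<longleftrightarrow> e = l \<and> l \<in> Src"
  by (auto simp: src_label_def)

text \<open>A label is created on the arc that it names and elsewhere only copied. The arcs with
  \<open>label src_label l = Some l\<close> are the roots.\<close>

lemma root_label:
  assumes "e \<in> arcs G" "label src_label e = Some l"
  shows "l \<in> arcs G \<and> label src_label l = Some l"
  using assms
proof (induction e rule: line_induct)
  case (step e)
  from step.hyps show ?case
  proof (cases rule: label_cases[of e src_label])
    case (copy l')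
    then have "l \<in> in_labels src_label e" using step.prems by auto
    then show ?thesis using step.IH by (auto simp: in_labels_def)
  qed (use step in \<open>auto simp: src_label_Some\<close>)
qed

lemma root_descendant: "e \<in> arcs G \<Longrightarrow> label src_label e = Some l \<Longrightarrow> (l, e) \<in> line_rel\<^sup>*"
  by (rule label_descendant) (auto simp: src_label_Some)

text \<open>A root that copied its label would have received its own name from an earlier arc, which
  in turn descends from the root: a cycle.\<close>

lemma root_two_labels:
  assumes "l \<in> arcs G" "label src_label l = Some l" "l \<notin> Src"
  obtains a b where "a \<in> in_labels src_label l" "b \<in> in_labels src_label l" "a \<noteq> b"
  using assms(1)
proof (cases rule: label_cases[of l src_label])
  case (copy a)
  then have "l \<in> in_labels src_label l" using assms(2) by auto
  then obtain e' where e': "e' \<in> arcs G" "head G e' = tail G l" "label src_label e' = Some l"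
    by (auto simp: in_labels_def)
  then have "(e', l) \<in> line_rel" using assms(1) by (auto simp: line_rel_def)
  then show ?thesis using root_descendant[OF e'(1,3)] line_acyclic' by blast
qed (use assms that in \<open>auto simp: src_label_Some\<close>)

text \<open>If every path from the sources to \<open>e\<close> runs through \<open>g\<close>, each
  arc entering the tail of \<open>e\<close> is \<open>g\<close> or again dominated by
  \<open>g\<close>. So no label but that of \<open>g\<close> arrives, and no new one is
  started.\<close>

lemma dominated_label:
  assumes "e \<in> arcs G" "e = g \<or> (\<forall>f\<in>Src. \<not> avoiding_reachable {g} (tail G f) (tail G e))"
  shows "label src_label e = None \<or> label src_label e = label src_label g"
  using assms
proof (induction e rule: line_induct)
  case (step e)
  show ?case
  proof (cases "e = g")
    case False
    then have dom: "\<not> avoiding_reachable {g} (tail G f) (tail G e)" if "f \<in> Src" for f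
      using step.prems that by blast
    have "e \<notin> Src" using dom avoiding_reachable_refl by blast
    have lab: "label src_label e' = None \<or> label src_label e' = label src_label g"
      if e': "e' \<in> arcs G" "head G e' = tail G e" for e'
    proof (rule step.IH[OF e'], rule disjCI)
      assume "\<not> (\<forall>f\<in>Src. \<not> avoiding_reachable {g} (tail G f) (tail G e'))"
      then obtain f where "f \<in> Src" "avoiding_reachable {g} (tail G f) (tail G e')" by blast
      then show "e' = g"
        using avoiding_reachable_step[of "{g}" _ e'] e' dom by (metis singletonD)
    qed
    have *: "Some l = label src_label g" if l: "l \<in> in_labels src_label e" for l
    proof -
      obtain e' where "e' \<in> arcs G" "head G e' = tail G e" "label src_label e' = Some l"
        using l by (auto simp: in_labels_def)
      then show ?thesis using lab[of e'] by simp
    qed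
    from step.hyps show ?thesis
    proof (cases rule: label_cases[of e src_label])
      case (source l)
      then show ?thesis using \<open>e \<notin> Src\<close> by (auto simp: src_label_Some)
    next
      case (fresh l l')
      then show ?thesis using *[of l] *[of l'] by (metis option.inject)
    next
      case (copy l)
      then show ?thesis using *[of l] by simp
    qed simp
  qed simp
qed

text \<open>
  If some roots (arcs that start their own symbol) are made to carry prescribed symbols, then every
  arc that used to carry the symbol of such a root carries the prescribed one: no other root lies
  between the root and the arc.
\<close>

lemma label_transfer:
  assumes "\<And>x. \<sigma> x \<noteq> src_label x \<Longrightarrow> label src_label x = Some x"
    and "\<sigma> u = Some a" "e \<in> arcs G"
  shows "(label src_label e = None \<longrightarrow> label \<sigma> e = None) \<and>
    (label src_label e = Some u \<longrightarrow> label \<sigma> e = Some a)"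
  using assms(3)
proof (induction e rule: line_induct)
  case (step e)
  show ?case
  proof (intro conjI impI)
    assume none: "label src_label e = None"
    then have "src_label e = None"
      by (metis label_source[OF step.hyps] option.exhaust option.distinct(1))
    then have "\<sigma> e = None" using assms(1)[of e] none by (metis option.distinct(1))
    have "in_labels src_label e = {}"
      using step.hyps by (cases rule: label_cases[of e src_label]) (use none in auto)
    then have "label src_label e' = None" if "e' \<in> arcs G" "head G e' = tail G e" for e'
      using in_labelsI[OF that] \<open>in_labels src_label e = {}\<close> by (cases "label src_label e'") auto
    then have "label \<sigma> e' = None" if "e' \<in> arcs G" "head G e' = tail G e" for e'
      using step.IH that by blast
    then have "in_labels \<sigma> e = {}" by (simp add: in_labels_def)
    then show "label \<sigma> e = None" using \<open>\<sigma> e = None\<close> label_rec[OF step.hyps, of \<sigma>] by simp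
  next
    assume some: "label src_label e = Some u"
    show "label \<sigma> e = Some a"
    proof (cases "e = u")
      case True
      then show ?thesis using label_source[OF step.hyps, of \<sigma> a] assms(2) by simp
    next
      case False
      from step.hyps have src: "src_label e = None" and lab: "in_labels src_label e = {u}"
        by (cases rule: label_cases[of e src_label]; use False some in \<open>auto simp: src_label_Some\<close>)+
      \<comment> \<open>The label of \<open>e\<close> is \<open>u\<close> and not \<open>e\<close>,
        so \<open>e\<close> is no root and its prescription is unchanged.\<close>
      have "\<sigma> e = None" using assms(1)[of e] src some False by (metis option.inject)
      have *: "label src_label e' = None \<or> label src_label e' = Some u"
        if "e' \<in> arcs G" "head G e' = tail G e" for e'
        using in_labelsI[OF that] lab by (cases "label src_label e'") auto
      have "u \<in> in_labels src_label e" using lab by simp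
      then obtain e' where e': "e' \<in> arcs G" "head G e' = tail G e" "label src_label e' = Some u"
        by (auto simp: in_labels_def)
      then have "label \<sigma> e' = Some a" using step.IH[OF e'(1,2)] by blast
      then have "a \<in> in_labels \<sigma> e" by (rule in_labelsI[OF e'(1,2)])
      moreover have "l = a" if l: "l \<in> in_labels \<sigma> e" for l
      proof -
        obtain e' where e': "e' \<in> arcs G" "head G e' = tail G e" "label \<sigma> e' = Some l"
          using l by (auto simp: in_labels_def)
        show ?thesis using *[OF e'(1,2)] step.IH[OF e'(1,2)] e'(3) by auto
      qed
      ultimately have "in_labels \<sigma> e = {a}" by blast
      then show ?thesis using \<open>\<sigma> e = None\<close> label_rec[OF step.hyps, of \<sigma>] by simp
    qed
  qed
qed

end

section \<open>Labellings of two-pair networks\<close>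

context two_pair_unicast_network
begin

definition source_arc_set :: "'e set" where
  "source_arc_set = {S 1, S 2}"

sublocale labelled_digraph G source_arc_set
proof unfold_locales
  show "wf line_rel" by (rule wf_line_rel[OF no_cycle])
  show "source_arc_set \<subseteq> arcs G"
    using source_arcs[of 1] source_arcs[of 2] by (auto simp: out_arcs_def source_arc_set_def)
qed

lemma S_arc: assumes "i \<in> {1, 2}" shows "S i \<in> arcs G" "tail G (S i) = s i"
  using source_arcs[OF assms] by (auto simp: out_arcs_def)

lemma T_arc: assumes "i \<in> {1, 2}" shows "T i \<in> arcs G" "head G (T i) = t i"
  using sink_arcs[OF assms] by (auto simp: in_arcs_def)

lemma S_unique: assumes "i \<in> {1, 2}" "e \<in> arcs G" "tail G e = s i" shows "e = S i"
  using source_arcs[OF assms(1)] assms(2,3) by (auto simp: out_arcs_def)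

lemma T_unique: assumes "i \<in> {1, 2}" "e \<in> arcs G" "head G e = t i" shows "e = T i"
  using sink_arcs[OF assms(1)] assms(2,3) by (auto simp: in_arcs_def)

lemma head_neq_s: assumes "i \<in> {1, 2}" "e \<in> arcs G" shows "head G e \<noteq> s i"
  using source_arcs[OF assms(1)] assms(2) by (auto simp: in_arcs_def)

lemma tail_neq_t: assumes "i \<in> {1, 2}" "e \<in> arcs G" shows "tail G e \<noteq> t i"
  using sink_arcs[OF assms(1)] assms(2) by (auto simp: out_arcs_def)

lemma s_neq_t: "i \<in> {1, 2} \<Longrightarrow> j \<in> {1, 2} \<Longrightarrow> s i \<noteq> t j"
  using terminals_distinct by auto

lemma s_in_verts: "i \<in> {1, 2} \<Longrightarrow> s i \<in> verts G"
  using terminals_in_verts by auto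

lemma terminals_inj:
  assumes "i \<in> {1, 2}" "j \<in> {1, 2}" "i \<noteq> j"
  shows "s i \<noteq> s j" "t i \<noteq> t j"
  using terminals_distinct assms by auto

lemma S_inj:
  assumes "i \<in> {1, 2}" "j \<in> {1, 2}" "i \<noteq> j"
  shows "S i \<noteq> S j"
  using terminals_inj(1)[OF assms] S_arc(2) assms(1,2) by metis

lemma reachable_s:
  assumes "i \<in> {1, 2}" "avoiding_reachable B u (s i)"
  shows "u = s i"
  using assms(2) by (rule avoiding_reachable_cases) (use head_neq_s[OF assms(1)] in blast)+

lemma reachable_from_t:
  assumes "i \<in> {1, 2}" "avoiding_reachable B (t i) v"
  shows "v = t i"
  using assms(2) by (induction rule: avoiding_reachable_induct) (use tail_neq_t[OF assms(1)] in auto)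

text \<open>No arc enters \<open>s i\<close>, so a path from the other source cannot use
  \<open>S i\<close>. With the mirror image for \<open>T i\<close>, the terminal arcs of one pair
  never block the other pair.\<close>

lemma reachable_avoiding_S:
  assumes "i \<in> {1, 2}" "j \<in> {1, 2}" "i \<noteq> j" "avoiding_reachable B (s j) v"
  shows "avoiding_reachable (insert (S i) B) (s j) v"
proof (rule ccontr)
  assume "\<not> ?thesis"
  then have "\<not> avoiding_reachable (B \<union> {S i}) (s j) v" by simp
  with assms(4) obtain a where "a \<in> {S i}" "avoiding_reachable B (s j) (tail G a)"
    by (rule avoiding_reachable_hits_tail)
  then have "avoiding_reachable B (s j) (s i)" using S_arc(2)[OF assms(1)] by simp
  then show False using reachable_s[OF assms(1)] terminals_inj(1)[OF assms(1-3)] by metis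
qed

lemma reachable_avoiding_T:
  assumes "i \<in> {1, 2}" "j \<in> {1, 2}" "i \<noteq> j" "avoiding_reachable B u (t j)"
  shows "avoiding_reachable (insert (T i) B) u (t j)"
proof (rule ccontr)
  assume "\<not> ?thesis"
  with assms(4) have "avoiding_reachable B (t i) (t j)"
    using avoiding_reachable_hits_head T_arc(2)[OF assms(1)] by metis
  then show False using reachable_from_t[OF assms(1)] terminals_inj(2)[OF assms(1-3)] by metis
qed

lemma unreachable_T:
  assumes "i \<in> {1, 2}" "j \<in> {1, 2}" "T j \<in> B \<or> \<not> avoiding_reachable B (s i) (tail G (T j))"
  shows "\<not> avoiding_reachable B (s i) (t j)"
proof
  assume "avoiding_reachable B (s i) (t j)"
  then show False
  proof (cases rule: avoiding_reachable_cases)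
    case 1
    then show False using s_neq_t assms(1,2) by blast
  next
    case (2 e)
    then show False using T_unique[OF assms(2) 2(1,3)] assms(3) by metis
  qed
qed

lemma S_in_source_arc_set: "i \<in> {1, 2} \<Longrightarrow> S i \<in> source_arc_set"
  by (auto simp: source_arc_set_def)

lemma src_label_s:
  assumes "i \<in> {1, 2}" "f \<in> arcs G" "tail G f = s i"
  shows "src_label f \<noteq> None"
  using S_unique[OF assms] S_in_source_arc_set[OF assms(1)] by (simp add: src_label_def)

lemma sink_label_exists:
  assumes "i \<in> {1, 2}" "avoiding_reachable {} (s i) (t i)"
  obtains u where "label src_label (T i) = Some u"
proof (cases "label src_label (T i)")
  case None
  \<comment> \<open>With \<open>Q\<close> empty nothing is deleted: an unlabelled arc is not
    reachable from a source at all.\<close>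
  then have "\<not> avoiding_reachable ({} \<union> {f. \<exists>l\<in>{}. src_label f = Some l}) (s i) (tail G (T i))"
    by (intro label_unreachable[OF T_arc(1)[OF assms(1)] src_label_s[OF assms(1)]]) simp_all
  then show ?thesis using unreachable_T[of i i "{}"] assms by simp
qed (use that in blast)

text \<open>\<open>label_unreachable\<close> with \<open>Q = {u}\<close>: sources are prescribed
  only their own names, so the deleted set is just \<open>{u}\<close>. Thus the root of
  \<open>T i\<close> separates both sources from \<open>t i\<close>.\<close>

lemma sink_label_unavoidable:
  assumes "i \<in> {1, 2}" "k \<in> {1, 2}" "label src_label (T i) = Some u"
  shows "\<not> avoiding_reachable {u} (s k) (t i)"
proof -
  have B: "{u} \<union> {f. \<exists>l\<in>{u}. src_label f = Some l} = {u}" by (auto simp: src_label_Some)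
  have "\<not> avoiding_reachable {u} (s k) (tail G (T i))" if "T i \<noteq> u"
    using label_unreachable[of "T i" "s k" src_label "{u}", OF T_arc(1)[OF assms(1)] src_label_s[OF assms(2)]] that assms(3)
    unfolding B by simp
  then show ?thesis using unreachable_T[OF assms(2,1), of "{u}"] by blast
qed

text \<open>The combinatorial form of a scalar linear code. Distinct labels stand for linearly
  independent symbols, with \<open>S i\<close> standing for the \<open>i\<close>-th message; each
  arc is silent, repeats an incoming symbol, or sees two different ones and can therefore form any
  symbol.\<close>

definition valid_labelling :: "('e \<Rightarrow> 'e option) \<Rightarrow> bool" where
  "valid_labelling K \<longleftrightarrow>
     (\<forall>i\<in>{1, 2}. K (S i) = Some (S i) \<and> K (T i) = Some (S i)) \<and>
     (\<forall>e\<in>arcs G. \<forall>l. K e = Some l \<longrightarrow> l \<in> arcs G) \<and>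
     (\<forall>e\<in>arcs G - {S 1, S 2}. K e = None \<or> (\<exists>e'\<in>in_arcs G (tail G e). K e' = K e) \<or>
        (\<exists>e'\<in>in_arcs G (tail G e). \<exists>e''\<in>in_arcs G (tail G e). \<exists>l l'.
           K e' = Some l \<and> K e'' = Some l' \<and> l \<noteq> l'))"

text \<open>
  If the tail of \<open>w\<close> saw a single symbol \<open>g\<close>, then \<open>g\<close> would dominate \<open>w\<close>, which contradicts that \<open>w\<close> is
  a root, unless \<open>g\<close> is the symbol forced on \<open>u\<close>; in that case every path from \<open>s j\<close> to \<open>w\<close>
  runs through \<open>u\<close>, and \<open>u\<close> is a bottleneck.
\<close>

lemma two_labels_after_relabelling:
  assumes ij: "i \<in> {1, 2}" "j \<in> {1, 2}" "i \<noteq> j"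
    and no_bottleneck: "\<And>e. \<not> avoiding_reachable {e} (s i) (t i) \<Longrightarrow>
      \<not> avoiding_reachable {e} (s j) (t j) \<Longrightarrow> avoiding_reachable {e} (s j) (t i)"
    and u: "label src_label (T i) = Some u" and w: "label src_label (T j) = Some w"
    and "u \<noteq> w" "u \<noteq> S j" "w \<noteq> S i" "w \<noteq> S j"
  obtains a b where "a \<in> in_labels (src_label(u := Some (S i))) w"
    "b \<in> in_labels (src_label(u := Some (S i))) w" "a \<noteq> b"
proof (rule ccontr)
  let ?\<sigma> = "src_label(u := Some (S i))"
  assume "\<not> thesis"
  then have eq: "a = b" if "a \<in> in_labels ?\<sigma> w" "b \<in> in_labels ?\<sigma> w" for a b
    using that \<open>\<And>b a. \<lbrakk>a \<in> in_labels ?\<sigma> w; b \<in> in_labels ?\<sigma> w; a \<noteq> b\<rbrakk> \<Longrightarrow> thesis\<close> by blast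
  have w_arc: "w \<in> arcs G" and w_root: "label src_label w = Some w"
    using root_label[OF T_arc(1)[OF ij(2)] w] by auto
  have S12: "source_arc_set = {S i, S j}" using ij by (auto simp: source_arc_set_def)
  have "w \<notin> source_arc_set" using assms(9,10) unfolding S12 by blast
  then have \<sigma>w: "?\<sigma> w = None" using \<open>u \<noteq> w\<close> by (simp add: src_label_def)
  have \<sigma>s: "?\<sigma> f \<noteq> None" if "k \<in> {1, 2}" "f \<in> arcs G" "tail G f = s k" for f k
    using src_label_s[OF that] by simp
  \<comment> \<open>If no label arrives at all, \<open>S i\<close> serves as \<open>g\<close>, which
    subsumes this case under the first one below.\<close>
  obtain g where g: "in_labels ?\<sigma> w \<subseteq> {g}" "g = S i \<or> g \<in> in_labels ?\<sigma> w"
    using eq by (cases "in_labels ?\<sigma> w = {}") blast+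
  have unreach: "\<not> avoiding_reachable ({g} \<union> {f. \<exists>l\<in>{g}. ?\<sigma> f = Some l}) (s k) (tail G w)"
    if "k \<in> {1, 2}" for k
    by (rule in_labels_unreachable[OF w_arc \<sigma>s[OF that] g(1) \<sigma>w])
  show False
  proof (cases "g = S i")
    case True
    \<comment> \<open>The label \<open>S i\<close> is prescribed on \<open>S i\<close> and on
      \<open>u\<close>; paths from \<open>s j\<close> avoid \<open>S i\<close> anyway, so
      \<open>u\<close> alone separates \<open>s j\<close> from \<open>w\<close>.\<close>
    have "{g} \<union> {f. \<exists>l\<in>{g}. ?\<sigma> f = Some l} = insert (S i) {u}"
      unfolding True by (auto simp: src_label_Some)
    then have "\<not> avoiding_reachable {u} (s j) (tail G w)"
      using unreach[OF ij(2)] reachable_avoiding_S[OF ij, of "{u}"] by metis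
    moreover have "\<not> avoiding_reachable {w} (s j) (t j)" by (rule sink_label_unavoidable[OF ij(2,2) w])
    then have "\<not> avoiding_reachable ({u} \<union> {w}) (s j) (t j)"
      using avoiding_reachable_mono[of "{u} \<union> {w}" "s j" "t j" "{w}"] by blast
    \<comment> \<open>A path from \<open>s j\<close> to \<open>t j\<close> that avoids
      \<open>u\<close> must still use \<open>w\<close>, and its part before \<open>w\<close> would
      reach the tail of \<open>w\<close> without \<open>u\<close>.\<close>
    ultimately have "\<not> avoiding_reachable {u} (s j) (t j)"
      using avoiding_reachable_hits_tail[of "{u}" "s j" "t j" "{w}"] by blast
    then show False
      using no_bottleneck sink_label_unavoidable[OF ij(1) _ u] ij by blast
  next
    case False
    then obtain e' where e': "e' \<in> arcs G" "head G e' = tail G w" "label ?\<sigma> e' = Some g"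
      using g(2) by (auto simp: in_labels_def)
    have own: "f = g" if "?\<sigma> f = Some g" for f
      using that False by (auto simp: src_label_Some split: if_splits)
    have "(e', w) \<in> line_rel" using e' w_arc by (auto simp: line_rel_def)
    moreover have "(g, e') \<in> line_rel\<^sup>*" by (rule label_descendant[OF e'(1,3) own])
    ultimately have "(g, w) \<in> line_rel\<^sup>+" by (rule rtrancl_into_trancl1[rotated])
    have "l \<in> arcs G" if "?\<sigma> f = Some l" for f l
      using that Src_arcs S_arc(1)[OF ij(1)] by (auto simp: src_label_Some split: if_splits)
    then have "g \<in> arcs G" by (rule label_in_arcs[OF e'(1,3)])
    have B: "{g} \<union> {f. \<exists>l\<in>{g}. ?\<sigma> f = Some l} = {g}" using own by blast
    have "\<not> avoiding_reachable {g} (s k) (tail G w)" if "k \<in> {1, 2}" for k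
      using unreach[OF that] unfolding B .
    then have "\<forall>f\<in>source_arc_set. \<not> avoiding_reachable {g} (tail G f) (tail G w)"
      using S_arc(2) by (auto simp: source_arc_set_def)
    \<comment> \<open>As \<open>g\<close> dominates \<open>w\<close>, in the original labelling
      \<open>g\<close> carries the symbol \<open>w\<close> and so lies downstream of
      \<open>w\<close>; but \<open>g\<close> also lies strictly upstream of
      \<open>w\<close>.\<close>
    then have "label src_label g = Some w"
      using dominated_label[OF w_arc, of g] w_root by auto
    then have "(w, g) \<in> line_rel\<^sup>*" by (rule root_descendant[OF \<open>g \<in> arcs G\<close>])
    then show False using \<open>(g, w) \<in> line_rel\<^sup>+\<close> by (rule line_acyclic')
  qed
qed

text \<open>Prescribe \<open>S i\<close> at the root \<open>u\<close> and \<open>S j\<close> at the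
  root \<open>w\<close>. Since \<open>u\<close> is not downstream of \<open>w\<close>, the two
  labels that arrive at \<open>u\<close> are the original ones, while \<open>w\<close> is handled by
  \<open>two_labels_after_relabelling\<close>.\<close>

lemma valid_labelling_ordered:
  assumes ij: "i \<in> {1, 2}" "j \<in> {1, 2}" "i \<noteq> j"
    and reach: "avoiding_reachable {} (s i) (t i)" "avoiding_reachable {} (s j) (t j)"
    and no_bottleneck: "\<And>e. \<not> avoiding_reachable {e} (s i) (t i) \<Longrightarrow>
      \<not> avoiding_reachable {e} (s j) (t j) \<Longrightarrow> avoiding_reachable {e} (s j) (t i)"
    and u: "label src_label (T i) = Some u" and w: "label src_label (T j) = Some w"
    and order: "(w, u) \<notin> line_rel\<^sup>*"
  shows "\<exists>K. valid_labelling K"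
proof -
  have "u \<noteq> w" using order by auto
  have u_arc: "u \<in> arcs G" and u_root: "label src_label u = Some u"
    using root_label[OF T_arc(1)[OF ij(1)] u] by auto
  have w_arc: "w \<in> arcs G" and w_root: "label src_label w = Some w"
    using root_label[OF T_arc(1)[OF ij(2)] w] by auto
  have uSj: "u \<noteq> S j"
    using sink_label_unavoidable[OF ij(1,1) u] reachable_avoiding_S[OF ij(2,1) _ reach(1)] ij(3) by auto
  have wSi: "w \<noteq> S i"
    using sink_label_unavoidable[OF ij(2,2) w] reachable_avoiding_S[OF ij _] reach(2) by auto
  have S12: "source_arc_set = {S i, S j}" using ij by (auto simp: source_arc_set_def)
  let ?\<sigma>1 = "src_label(u := Some (S i))"
  define \<sigma> where "\<sigma> = ?\<sigma>1(w := Some (S j))"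
  have \<sigma>u: "\<sigma> u = Some (S i)" and \<sigma>w: "\<sigma> w = Some (S j)" using \<open>u \<noteq> w\<close> by (simp_all add: \<sigma>_def)
  \<comment> \<open>Prescriptions change only at roots, so \<open>label_transfer\<close> carries the
    new symbols of \<open>u\<close> and \<open>w\<close> on to \<open>T i\<close> and
    \<open>T j\<close>.\<close>
  have transfer: "label src_label x = Some x" if "\<sigma> x \<noteq> src_label x" for x
    using that u_root w_root by (auto simp: \<sigma>_def split: if_splits)
  have KT: "label \<sigma> (T i) = Some (S i)" "label \<sigma> (T j) = Some (S j)"
    using label_transfer[of \<sigma>, OF transfer \<sigma>u T_arc(1)[OF ij(1)]] u
      label_transfer[of \<sigma>, OF transfer \<sigma>w T_arc(1)[OF ij(2)]] w by auto
  have "src_label (S i) = Some (S i)" "src_label (S j) = Some (S j)"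
    using S_in_source_arc_set ij by (simp_all only: src_label_def if_True)
  then have "\<sigma> (S i) = Some (S i)" "\<sigma> (S j) = Some (S j)"
    using uSj wSi by (auto simp: \<sigma>_def)
  then have KS: "label \<sigma> (S i) = Some (S i)" "label \<sigma> (S j) = Some (S j)"
    using label_source[OF S_arc(1)] ij by blast+
  have arcs: "l \<in> arcs G" if "e \<in> arcs G" "label \<sigma> e = Some l" for e l
  proof (rule label_in_arcs[OF that])
    show "m \<in> arcs G" if "\<sigma> f = Some m" for f m
      using that Src_arcs S_arc(1) ij
      by (auto simp: \<sigma>_def src_label_Some split: if_splits)
  qed
  \<comment> \<open>If \<open>u\<close> or \<open>w\<close> is a source arc, it emits a message and
    has nothing to compute.\<close>
  have two: "\<exists>a\<in>in_labels \<sigma> e. \<exists>b\<in>in_labels \<sigma> e. a \<noteq> b" if e: "e = u \<or> e = w" "e \<notin> source_arc_set" for e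
  proof (cases "e = u")
    case True
    have "in_labels \<sigma> u = in_labels src_label u"
    proof (rule in_labels_cong[OF u_arc])
      fix f assume "\<sigma> f \<noteq> src_label f"
      then have "f = u \<or> f = w" by (auto simp: \<sigma>_def split: if_splits)
      then show "(f, u) \<notin> line_rel\<^sup>+" using order line_acyclic[of u] trancl_into_rtrancl by metis
    qed
    moreover obtain a b where "a \<in> in_labels src_label u" "b \<in> in_labels src_label u" "a \<noteq> b"
      using root_two_labels[OF u_arc u_root] e(2) True by metis
    ultimately show ?thesis using True by metis
  next
    case False
    then have [simp]: "e = w" using e by blast
    have "in_labels \<sigma> w = in_labels ?\<sigma>1 w"
    proof (rule in_labels_cong[OF w_arc])
      fix f assume "\<sigma> f \<noteq> ?\<sigma>1 f"
      then have "f = w" by (auto simp: \<sigma>_def split: if_splits)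
      then show "(f, w) \<notin> line_rel\<^sup>+" using line_acyclic[of w] by simp
    qed
    moreover have "w \<noteq> S j" using e(2) unfolding S12 by simp
    then obtain a b where "a \<in> in_labels ?\<sigma>1 w" "b \<in> in_labels ?\<sigma>1 w" "a \<noteq> b"
      using two_labels_after_relabelling[OF ij no_bottleneck u w \<open>u \<noteq> w\<close> uSj wSi] by metis
    ultimately show ?thesis using \<open>e = w\<close> by metis
  qed
  have "label \<sigma> e = None \<or> (\<exists>e'\<in>in_arcs G (tail G e). label \<sigma> e' = label \<sigma> e) \<or>
        (\<exists>e'\<in>in_arcs G (tail G e). \<exists>e''\<in>in_arcs G (tail G e). \<exists>l l'.
           label \<sigma> e' = Some l \<and> label \<sigma> e'' = Some l' \<and> l \<noteq> l')" (is "?V e")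
    if e: "e \<in> arcs G - {S 1, S 2}" for e
  proof (cases "e = u \<or> e = w")
    case True
    then obtain a b where "a \<in> in_labels \<sigma> e" "b \<in> in_labels \<sigma> e" "a \<noteq> b"
      using two[of e] e unfolding source_arc_set_def by blast
    then show ?thesis unfolding in_labels_def by blast
  next
    case False
    have "e \<in> arcs G" using e by blast
    then show ?thesis
    proof (cases rule: label_cases[of e \<sigma>])
      case (source l)
      then have "e \<in> source_arc_set" using False by (simp add: \<sigma>_def src_label_Some)
      then show ?thesis using e unfolding source_arc_set_def by blast
    next
      case (copy l)
      then have "l \<in> in_labels \<sigma> e" by simp
      then show ?thesis using copy(3) unfolding in_labels_def by auto
    next
      case (fresh l l')
      then show ?thesis unfolding in_labels_def by blast
    qed simp
  qed
  moreover have "\<forall>k\<in>{1, 2}. label \<sigma> (S k) = Some (S k) \<and> label \<sigma> (T k) = Some (S k)"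
    using KS KT ij by auto
  ultimately have "valid_labelling (label \<sigma>)"
    unfolding valid_labelling_def using arcs by blast
  then show ?thesis by blast
qed

text \<open>Two distinct roots cannot each lie downstream of the other, so the pairs can be numbered
  as \<open>valid_labelling_ordered\<close> requires.\<close>

lemma valid_labelling_exists:
  assumes reach: "\<And>i. i \<in> {1, 2} \<Longrightarrow> avoiding_reachable {} (s i) (t i)"
    and no_bottleneck: "\<And>e. \<not> avoiding_reachable {e} (s 1) (t 1) \<Longrightarrow>
      \<not> avoiding_reachable {e} (s 2) (t 2) \<Longrightarrow>
      avoiding_reachable {e} (s 1) (t 2) \<and> avoiding_reachable {e} (s 2) (t 1)"
  shows "\<exists>K. valid_labelling K"
proof -
  obtain u w where u: "label src_label (T 1) = Some u" and w: "label src_label (T 2) = Some w"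
    using sink_label_exists reach by (metis insertI1 insertI2)
  \<comment> \<open>A common root of \<open>T 1\<close> and \<open>T 2\<close> would separate both
    sources from both sinks.\<close>
  have "u \<noteq> w"
    using no_bottleneck[of u] sink_label_unavoidable[OF _ _ u] sink_label_unavoidable[OF _ _ w] by auto
  show ?thesis
  proof (cases "(w, u) \<in> line_rel\<^sup>*")
    case False
    then show ?thesis
      using valid_labelling_ordered[of 1 2 u w] reach no_bottleneck u w by simp
  next
    case True
    then have "(w, u) \<in> line_rel\<^sup>+" using \<open>u \<noteq> w\<close> by (metis rtranclD)
    then have "(u, w) \<notin> line_rel\<^sup>*" using line_acyclic' by blast
    then show ?thesis
      using valid_labelling_ordered[of 2 1 w u] reach no_bottleneck u w by simp
  qed
qed

end

section \<open>Linear codes\<close>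

text \<open>Subtracting the congruences leaves \<open>(m - n) * (b - b')\<close>, in which
  \<open>m - n\<close> is invertible modulo \<open>p\<close>.\<close>

lemma linear_forms_determine:
  fixes p m n :: int
  assumes "prime p" "\<not> [m = n] (mod p)"
    and "[a + m * b = a' + m * b'] (mod p)" "[a + n * b = a' + n * b'] (mod p)"
  shows "[a = a'] (mod p)" "[b = b'] (mod p)"
proof -
  have "[(a + m * b) - (a + n * b) = (a' + m * b') - (a' + n * b')] (mod p)"
    using assms(3,4) by (rule cong_diff)
  then have "p dvd (m - n) * (b - b')"
    by (simp add: cong_iff_dvd_diff algebra_simps)
  then show b: "[b = b'] (mod p)"
    using assms(1,2) by (auto simp: prime_dvd_mult_iff cong_iff_dvd_diff)
  have "[(a + m * b) - m * b = (a' + m * b') - m * b'] (mod p)"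
    using assms(3) b by (intro cong_diff cong_scalar_left)
  then show "[a = a'] (mod p)" by simp
qed

section \<open>Two independent uniform messages\<close>

text \<open>The sample point encodes the pair of messages.\<close>

definition message :: "nat \<Rightarrow> nat \<Rightarrow> nat \<Rightarrow> nat" where
  "message p i \<omega> = (if i = 1 then fst (prod_decode \<omega>) else snd (prod_decode \<omega>)) mod p"

text \<open>Reduction modulo \<open>p\<close> secures the bound at every sample point, also outside
  the support of \<open>message_space\<close>, because \<open>network_code\<close> constrains all
  sample points.\<close>

lemma message_less: "0 < p \<Longrightarrow> message p i \<omega> < p"
  by (simp add: message_def)

definition message_space :: "nat \<Rightarrow> nat pmf" where
  "message_space p = map_pmf prod_encode (pair_pmf (pmf_of_set {..<p}) (pmf_of_set {..<p}))"

lemma map_pmf_mod_lessThan: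
  fixes p :: nat
  assumes "0 < p"
  shows "map_pmf (\<lambda>a. a mod p) (pmf_of_set {..<p}) = pmf_of_set {..<p}"
proof -
  have "{..<p} \<noteq> {}" using assms by auto
  then have "map_pmf (\<lambda>a. a mod p) (pmf_of_set {..<p}) = map_pmf (\<lambda>a. a) (pmf_of_set {..<p})"
    by (intro map_pmf_cong) (auto simp: set_pmf_of_set[OF \<open>{..<p} \<noteq> {}\<close> finite_lessThan])
  then show ?thesis by simp
qed

lemma joint_message_distribution:
  assumes "0 < p"
  shows "map_pmf (\<lambda>\<omega>. (message p 1 \<omega>, message p 2 \<omega>)) (message_space p) =
    pair_pmf (pmf_of_set {..<p}) (pmf_of_set {..<p})"
proof -
  have "map_pmf (\<lambda>\<omega>. (message p 1 \<omega>, message p 2 \<omega>)) (message_space p) =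
    map_pmf (\<lambda>(a, b). (a mod p, b mod p)) (pair_pmf (pmf_of_set {..<p}) (pmf_of_set {..<p}))"
    by (simp add: message_space_def message_def pmf.map_comp o_def case_prod_unfold)
  also have "\<dots> = pair_pmf (pmf_of_set {..<p}) (pmf_of_set {..<p})"
    by (simp add: map_pair map_pmf_mod_lessThan[OF assms])
  finally show ?thesis .
qed

lemma message_distribution:
  assumes "0 < p" "i \<in> {1, 2}"
  shows "map_pmf (message p i) (message_space p) = pmf_of_set {..<p}"
proof -
  have "map_pmf fst (map_pmf (\<lambda>\<omega>. (message p 1 \<omega>, message p 2 \<omega>)) (message_space p)) =
      pmf_of_set {..<p}"
    unfolding joint_message_distribution[OF assms(1)] by (rule map_fst_pair_pmf)
  moreover have "map_pmf snd (map_pmf (\<lambda>\<omega>. (message p 1 \<omega>, message p 2 \<omega>)) (message_space p)) =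
      pmf_of_set {..<p}"
    unfolding joint_message_distribution[OF assms(1)] by (rule map_snd_pair_pmf)
  ultimately show ?thesis using assms(2) by (auto simp: pmf.map_comp o_def)
qed

lemma messages_indep:
  assumes "0 < p"
  shows "prob_space.indep_var (measure_pmf (message_space p))
    (count_space UNIV) (message p 1) (count_space UNIV) (message p 2)"
  by (rule indep_var_if_pmf_map_pair)
    (use joint_message_distribution[OF assms] message_distribution[OF assms] in simp)

text \<open>The base of the logarithm is the alphabet size, so a uniform symbol has entropy exactly
  1.\<close>

lemma message_entropy:
  assumes "1 < p" "i \<in> {1, 2}"
  shows "prob_space.entropy (measure_pmf (message_space p)) (real p) (count_space UNIV) (message p i) = 1"
proof -
  have "pmf (map_pmf (message p i) (message_space p)) (message p i \<omega>) = 1 / real p" for \<omega>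
  proof -
    have "{..<p} \<noteq> {}" using assms(1) by auto
    then show ?thesis
      using message_distribution[OF _ assms(2), of p] message_less[of p i \<omega>] assms(1) by simp
  qed
  moreover have "log (real p) (1 / real p) = -1"
    using assms(1) by (simp add: log_divide)
  ultimately show ?thesis using assms(1) by (simp add: entropy_pmf)
qed

lemma conditional_entropy_self_pmf:
  fixes X :: "'a \<Rightarrow> 'b :: countable"
  assumes "1 < b"
  shows "prob_space.conditional_entropy (measure_pmf p) b (count_space UNIV) (count_space UNIV) X X = 0"
proof -
  have "pmf (map_pmf (\<lambda>w. (X w, X w)) p) (X w, X w) = pmf (map_pmf X p) (X w)" for w
    by (rule antisym) (rule pmf_map_mono, simp)+
  \<comment> \<open>For \<open>y = 0\<close> this rests on the default values of division and
    logarithm at 0.\<close>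
  moreover have "log b (y / y) = 0" for y :: real by (cases "y = 0") (simp_all add: log_def)
  ultimately show ?thesis by (simp add: conditional_entropy_pmf[OF assms])
qed

section \<open>From a valid labelling to a network coding solution\<close>

context two_pair_unicast_network
begin

text \<open>The label \<open>l\<close> is read as the first message, the second, or the first plus
  \<open>n l\<close> times the second modulo \<open>p\<close>. Any two such symbols determine both
  messages, and each has at most \<open>p\<close> values, so entropy at most 1.\<close>

lemma available_if_valid_labelling:
  assumes "valid_labelling K" and c_pos: "\<And>e. e \<in> arcs G \<Longrightarrow> 1 \<le> c e"
  shows "available G S T c"
proof -
  \<comment> \<open>The prime leaves room for one nonzero residue per arc. The \<open>+ 1\<close> in
    \<open>n\<close> keeps the multipliers away from 0, the multiplier of the first message
    alone.\<close>
  obtain p :: nat where p: "prime p" "card (arcs G) + 1 < p" using bigger_prime by blast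
  then have p1: "1 < p" "0 < p" by linarith+
  obtain h where h: "bij_betw h (arcs G) {0..<card (arcs G)}"
    using ex_bij_betw_finite_nat[OF finite_arcs] by blast
  define n where "n e = h e + 1" for e
  have n_less: "0 < n e \<and> n e < p" if "e \<in> arcs G" for e
    using bij_betwE[OF h] that p(2) by (fastforce simp: n_def)
  have n_inj: "n e \<noteq> n e'" if "e \<in> arcs G" "e' \<in> arcs G" "e \<noteq> e'" for e e'
    using bij_betw_imp_inj_on[OF h] that by (auto simp: n_def inj_on_def)
  let ?M = "message p"
  define symbol where "symbol l \<omega> = (if l = S 1 then ?M 1 \<omega> else if l = S 2 then ?M 2 \<omega>
      else (?M 1 \<omega> + n l * ?M 2 \<omega>) mod p)" for l \<omega>
  define X where "X e \<omega> = (case K e of None \<Rightarrow> 0 | Some l \<Rightarrow> symbol l \<omega>)" for e \<omega>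
  have S12: "S 1 \<noteq> S 2" using S_inj[of 1 2] by simp
  have X_less: "X e \<omega> \<in> {..<p}" for e \<omega>
    using p1 message_less[of p] by (simp add: X_def symbol_def split: option.split)
  have symbol_S: "symbol (S i) = ?M i" if "i \<in> {1, 2}" for i
    using that S12 by (auto simp: symbol_def fun_eq_iff)
  have X_ST: "X (S i) = ?M i" "X (T i) = ?M i" if "i \<in> {1, 2}" for i
    using assms(1) that symbol_S[OF that] by (auto simp: valid_labelling_def X_def fun_eq_iff)

  have cong_less: "a = a'" if "[int a = int a'] (mod int p)" "a < p" "a' < p" for a a'
    using cong_less_modulus_unique_nat[of a a' p] that by (simp only: cong_int_iff)
  have cong_form: "[int (?M 1 \<omega>) + int (n l) * int (?M 2 \<omega>) = int (?M 1 \<omega>') + int (n l) * int (?M 2 \<omega>')] (mod int p)"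
    if "symbol l \<omega> = symbol l \<omega>'" "l \<noteq> S 1" "l \<noteq> S 2" for l \<omega> \<omega>'
  proof -
    have "[?M 1 \<omega> + n l * ?M 2 \<omega> = ?M 1 \<omega>' + n l * ?M 2 \<omega>'] (mod p)"
      using that by (simp add: symbol_def cong_def)
    then have "[int (?M 1 \<omega> + n l * ?M 2 \<omega>) = int (?M 1 \<omega>' + n l * ?M 2 \<omega>')] (mod int p)"
      by (simp only: cong_int_iff)
    then show ?thesis by simp
  qed
  have n_not_cong: "\<not> [int a = int b] (mod int p)" if "a < p" "b < p" "a \<noteq> b" for a b
    using cong_less[OF _ that(1,2)] that(3) by blast
  have prime_int: "prime (int p)" using p(1) by simp
  have determine: "?M 1 \<omega> = ?M 1 \<omega>' \<and> ?M 2 \<omega> = ?M 2 \<omega>'"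
    if l: "l \<in> arcs G" "l' \<in> arcs G" "l \<noteq> l'"
      and eq: "symbol l \<omega> = symbol l \<omega>'" "symbol l' \<omega> = symbol l' \<omega>'" for l l' \<omega> \<omega>'
  proof -
    have both: "?M 1 \<omega> = ?M 1 \<omega>' \<and> ?M 2 \<omega> = ?M 2 \<omega>'"
      if "\<not> [a = b] (mod int p)"
        "[int (?M 1 \<omega>) + a * int (?M 2 \<omega>) = int (?M 1 \<omega>') + a * int (?M 2 \<omega>')] (mod int p)"
        "[int (?M 1 \<omega>) + b * int (?M 2 \<omega>) = int (?M 1 \<omega>') + b * int (?M 2 \<omega>')] (mod int p)" for a b
      by (intro conjI cong_less message_less p1(2) linear_forms_determine[OF prime_int that])
    have mixed: "?M 1 \<omega> = ?M 1 \<omega>' \<and> ?M 2 \<omega> = ?M 2 \<omega>'"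
      if k: "k \<in> arcs G" "k \<noteq> S 1" "k \<noteq> S 2" and s: "symbol k \<omega> = symbol k \<omega>'"
        and m: "?M 1 \<omega> = ?M 1 \<omega>' \<or> ?M 2 \<omega> = ?M 2 \<omega>'" for k
    proof (cases "?M 2 \<omega> = ?M 2 \<omega>'")
      case True
      then have "[int (?M 1 \<omega>) = int (?M 1 \<omega>')] (mod int p)"
        using cong_form[OF s k(2,3)] by (simp add: cong_add_rcancel)
      then have "?M 1 \<omega> = ?M 1 \<omega>'" by (rule cong_less) (rule message_less[OF p1(2)])+
      then show ?thesis using True by blast
    next
      case False
      then have "?M 1 \<omega> = ?M 1 \<omega>'" using m by blast
      \<comment> \<open>The first message is itself the form with multiplier 0, which differs from
        \<open>n k\<close> modulo \<open>p\<close>.\<close>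
      then show ?thesis
        using both[of "int (n k)" 0] cong_form[OF s k(2,3)] n_less[OF k(1)]
          n_not_cong[of "n k" 0] p1 by simp
    qed
    show ?thesis
    proof (cases "l \<in> {S 1, S 2}")
      case True
      then have m: "?M 1 \<omega> = ?M 1 \<omega>' \<or> ?M 2 \<omega> = ?M 2 \<omega>'" using eq(1) symbol_S by auto
      show ?thesis
      proof (cases "l' \<in> {S 1, S 2}")
        case True
        then show ?thesis using \<open>l \<in> {S 1, S 2}\<close> l(3) eq symbol_S by auto
      next
        case False
        then show ?thesis using mixed[OF l(2) _ _ eq(2) m] by blast
      qed
    next
      case lF: False
      show ?thesis
      proof (cases "l' \<in> {S 1, S 2}")
        case True
        then have m: "?M 1 \<omega> = ?M 1 \<omega>' \<or> ?M 2 \<omega> = ?M 2 \<omega>'" using eq(2) symbol_S by auto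
        show ?thesis using lF mixed[OF l(1) _ _ eq(1) m] by blast
      next
        case False
        have "\<not> [int (n l) = int (n l')] (mod int p)"
          by (rule n_not_cong) (use n_less[OF l(1)] n_less[OF l(2)] n_inj[OF l] in blast)+
        then show ?thesis
          by (rule both) (use cong_form[OF eq(1)] cong_form[OF eq(2)] lF False in blast)+
      qed
    qed
  qed

  have local: "X e \<omega> = X e \<omega>'"
    if e: "e \<in> arcs G - {S 1, S 2}" and eq: "\<And>e'. e' \<in> in_arcs G (tail G e) \<Longrightarrow> X e' \<omega> = X e' \<omega>'"
    for e \<omega> \<omega>'
  proof -
    have "K e = None \<or> (\<exists>e'\<in>in_arcs G (tail G e). K e' = K e) \<or>
        (\<exists>e'\<in>in_arcs G (tail G e). \<exists>e''\<in>in_arcs G (tail G e). \<exists>l l'.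
           K e' = Some l \<and> K e'' = Some l' \<and> l \<noteq> l')"
      using assms(1) e unfolding valid_labelling_def by blast
    then consider "K e = None" | e' where "e' \<in> in_arcs G (tail G e)" "K e' = K e"
      | e' e'' l l' where "e' \<in> in_arcs G (tail G e)" "e'' \<in> in_arcs G (tail G e)"
        "K e' = Some l" "K e'' = Some l'" "l \<noteq> l'"
      by (elim disjE bexE exE conjE) (assumption | blast)+
    then show ?thesis
    proof cases
      case 1
      then show ?thesis by (simp add: X_def)
    next
      case (2 e')
      then show ?thesis using eq[OF 2(1)] by (simp add: X_def)
    next
      case (3 e' e'' l l')
      have "e' \<in> arcs G" "e'' \<in> arcs G" using 3(1,2) by auto
      then have "l \<in> arcs G" "l' \<in> arcs G"
        using assms(1) 3(3,4) unfolding valid_labelling_def by blast+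
      moreover have "symbol l \<omega> = symbol l \<omega>'" "symbol l' \<omega> = symbol l' \<omega>'"
        using eq[OF 3(1)] eq[OF 3(2)] 3(3,4) by (simp_all add: X_def)
      ultimately have "?M 1 \<omega> = ?M 1 \<omega>' \<and> ?M 2 \<omega> = ?M 2 \<omega>'" using determine 3(5) by blast
      then show ?thesis by (simp add: X_def symbol_def split: option.split)
    qed
  qed
  \<comment> \<open>By \<open>local\<close>, \<open>X e\<close> may be evaluated at any sample point
    that produces the given incoming values.\<close>
  define f where "f e r = X e (SOME \<omega>. restrict (\<lambda>e'. X e' \<omega>) (in_arcs G (tail G e)) = r)" for e r
  have f: "X e \<omega> = f e (restrict (\<lambda>e'. X e' \<omega>) (in_arcs G (tail G e)))"
    if "e \<in> arcs G - {S 1, S 2}" for e \<omega>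
  proof -
    let ?r = "\<lambda>\<omega>. restrict (\<lambda>e'. X e' \<omega>) (in_arcs G (tail G e))"
    let ?\<omega>' = "SOME \<omega>'. ?r \<omega>' = ?r \<omega>"
    have "?r ?\<omega>' = ?r \<omega>" by (rule someI[of _ \<omega>]) (rule refl)
    then have r: "?r ?\<omega>' e' = ?r \<omega> e'" for e' by (rule fun_cong)
    have "X e' \<omega> = X e' ?\<omega>'" if "e' \<in> in_arcs G (tail G e)" for e'
      using r[of e', symmetric] that by (simp only: restrict_apply if_True)
    then show ?thesis unfolding f_def by (rule local[OF that])
  qed

  have entropy_le: "prob_space.entropy (measure_pmf (message_space p)) (real p) (count_space UNIV) (X e) \<le> real (c e)"
    if "e \<in> arcs G" for e
  proof -
    have "prob_space.entropy (measure_pmf (message_space p)) (real p) (count_space UNIV) (X e)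
        \<le> log (real p) (real (card {..<p}))"
      by (rule entropy_pmf_le_log_card) (use p1 X_less in auto)
    also have "\<dots> = 1" using p1 by simp
    also have "\<dots> \<le> real (c e)" using c_pos[OF that] by simp
    finally show ?thesis .
  qed
  have "network_code G S c (real p) (message_space p) ?M f X"
    unfolding network_code_def
  proof (intro conjI ballI allI)
    show "1 < real p" using p1 by simp
  qed (fact messages_indep[OF p1(2)] message_entropy[OF p1(1)] X_ST(1) f entropy_le)+
  moreover have "prob_space.conditional_entropy (measure_pmf (message_space p)) (real p)
        (count_space UNIV) (count_space UNIV) (X (S i)) (X (T i)) = 0" if "i \<in> {1, 2}" for i
    unfolding X_ST[OF that] by (rule conditional_entropy_self_pmf) (use p1 in simp)
  ultimately have "network_coding_solution G S T c (real p) (message_space p) ?M f X"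
    unfolding network_coding_solution_def by blast
  then show ?thesis unfolding available_def by blast
qed

end

section \<open>Necessity\<close>

text \<open>A non-integrable integrand would give entropy 0 by default, so a nonzero value certifies
  integrability.\<close>

lemma log_pmf_integrable_if_entropy_nonzero:
  fixes X :: "'a \<Rightarrow> 'b :: countable"
  assumes "1 < b" "prob_space.entropy (measure_pmf p) b (count_space UNIV) X \<noteq> 0"
  shows "integrable (measure_pmf p) (\<lambda>w. log b (pmf (map_pmf X p) (X w)))"
  using assms(2) not_integrable_integral_eq unfolding entropy_pmf[OF assms(1)] by force

text \<open>Larger probabilities have logarithms closer to 0, so the logarithm for \<open>X\<close>
  is an integrable bound. This serves both coarser variables and conditional probabilities.\<close>

lemma integrable_log_pmf_coarsening:
  assumes "1 < b" "integrable (measure_pmf p) (\<lambda>w. log b (pmf (map_pmf X p) (X w)))"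
    and "\<And>w. w \<in> set_pmf p \<Longrightarrow> pmf (map_pmf X p) (X w) \<le> r w \<and> r w \<le> 1"
  shows "integrable (measure_pmf p) (\<lambda>w. log b (r w))"
proof (rule Bochner_Integration.integrable_bound[OF assms(2)])
  show "AE w in measure_pmf p. norm (log b (r w)) \<le> norm (log b (pmf (map_pmf X p) (X w)))"
    unfolding AE_measure_pmf_iff
  proof
    fix w assume w: "w \<in> set_pmf p"
    have q: "0 < pmf (map_pmf X p) (X w)" by (rule pmf_map_apply_pos[OF w])
    have r: "pmf (map_pmf X p) (X w) \<le> r w" "r w \<le> 1" using assms(3)[OF w] by auto
    have "log b (pmf (map_pmf X p) (X w)) \<le> log b (r w)" using q r(1) assms(1) by simp
    moreover have "log b (r w) \<le> 0" using q r assms(1) by (simp add: log_le_zero_cancel_iff)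
    ultimately show "norm (log b (r w)) \<le> norm (log b (pmf (map_pmf X p) (X w)))" by simp
  qed
qed simp

text \<open>The negated logarithm of the conditional probability \<open>r\<close> is nonnegative
  with integral 0, so \<open>r\<close> is 1 on the support. A second point with equal
  \<open>Y\<close> but different \<open>X\<close> would add positive mass to the class of
  \<open>Y w\<close>.\<close>

lemma conditional_entropy_zero_determines:
  fixes X :: "'a \<Rightarrow> 'b :: countable" and Y :: "'a \<Rightarrow> 'c :: countable"
  assumes "1 < b"
    and zero: "prob_space.conditional_entropy (measure_pmf p) b (count_space UNIV) (count_space UNIV) X Y = 0"
    and int: "integrable (measure_pmf p) (\<lambda>w. log b (pmf (map_pmf (\<lambda>w. (X w, Y w)) p) (X w, Y w)))"
    and w: "w \<in> set_pmf p" "w' \<in> set_pmf p" "Y w = Y w'"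
  shows "X w = X w'"
proof (rule ccontr)
  assume neq: "X w \<noteq> X w'"
  let ?XY = "\<lambda>w. (X w, Y w)"
  define r where "r v = pmf (map_pmf ?XY p) (?XY v) / pmf (map_pmf Y p) (Y v)" for v
  have bounds: "pmf (map_pmf ?XY p) (?XY v) \<le> r v \<and> r v \<le> 1" "0 < r v" if "v \<in> set_pmf p" for v
  proof -
    have pos: "0 < pmf (map_pmf ?XY p) (?XY v)" "0 < pmf (map_pmf Y p) (Y v)"
      using pmf_map_apply_pos[OF that] by blast+
    have "pmf (map_pmf ?XY p) (?XY v) \<le> pmf (map_pmf Y p) (Y v)"
      by (rule pmf_map_mono) simp
    moreover have "pmf (map_pmf Y p) (Y v) \<le> 1" by (rule pmf_le_1)
    ultimately show "pmf (map_pmf ?XY p) (?XY v) \<le> r v \<and> r v \<le> 1"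
      using pos by (simp add: r_def pos_le_divide_eq mult_left_le)
    show "0 < r v" using pos by (simp add: r_def)
  qed
  \<comment> \<open>The library's conditional entropy is also 0 if the integral diverges.\<close>
  have "integrable (measure_pmf p) (\<lambda>v. log b (r v))"
    using integrable_log_pmf_coarsening[OF assms(1) int bounds(1)] .
  then have "integrable (measure_pmf p) (\<lambda>v. - log b (r v))" by simp
  moreover have "AE v in measure_pmf p. 0 \<le> - log b (r v)"
    unfolding AE_measure_pmf_iff using bounds assms(1) by (simp add: log_le_zero_cancel_iff)
  moreover have "(\<integral>v. - log b (r v) \<partial>measure_pmf p) = 0"
    using zero unfolding conditional_entropy_pmf[OF assms(1)] r_def by simp
  ultimately have "AE v in measure_pmf p. - log b (r v) = 0"
    using integral_nonneg_eq_0_iff_AE by blast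
  then have "log b (r w) = 0" using w(1) by (simp add: AE_measure_pmf_iff)
  then have "r w = 1" using bounds(2)[OF w(1)] assms(1) by (simp add: log_def)
  then have "measure (measure_pmf p) (?XY -` {?XY w}) = measure (measure_pmf p) (Y -` {Y w})"
    using pmf_map_apply_pos[OF w(1), of Y] by (simp add: r_def pmf_map)
  moreover have "measure (measure_pmf p) (?XY -` {?XY w} \<union> {w'}) =
      measure (measure_pmf p) (?XY -` {?XY w}) + measure (measure_pmf p) {w'}"
    using neq by (intro measure_pmf.finite_measure_Union) auto
  moreover have "measure (measure_pmf p) (?XY -` {?XY w} \<union> {w'}) \<le> measure (measure_pmf p) (Y -` {Y w})"
    using w(3) by (intro measure_pmf.finite_measure_mono) auto
  moreover have "0 < measure (measure_pmf p) {w'}"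
    using w(2) by (simp add: measure_pmf_single pmf_positive)
  ultimately show False by linarith
qed

text \<open>The joint probability factors, so its logarithm is a sum of two terms, each integrable
  because the entropies are nonzero.\<close>

lemma indep_pair_log_pmf:
  fixes X Y :: "'a \<Rightarrow> 'b :: countable"
  assumes "1 < b"
    and "prob_space.indep_var (measure_pmf p) (count_space UNIV) X (count_space UNIV) Y"
    and "prob_space.entropy (measure_pmf p) b (count_space UNIV) X = 1"
    and "prob_space.entropy (measure_pmf p) b (count_space UNIV) Y = 1"
  shows "integrable (measure_pmf p) (\<lambda>w. log b (pmf (map_pmf (\<lambda>w. (X w, Y w)) p) (X w, Y w)))"
    and "measure_pmf.expectation p (\<lambda>w. log b (pmf (map_pmf (\<lambda>w. (X w, Y w)) p) (X w, Y w))) = -2"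
proof -
  let ?x = "\<lambda>w. log b (pmf (map_pmf X p) (X w))" and ?y = "\<lambda>w. log b (pmf (map_pmf Y p) (Y w))"
  let ?xy = "\<lambda>w. log b (pmf (map_pmf (\<lambda>w. (X w, Y w)) p) (X w, Y w))"
  have int: "integrable (measure_pmf p) ?x" "integrable (measure_pmf p) ?y"
    by (rule log_pmf_integrable_if_entropy_nonzero; use assms in simp)+
  have ae: "AE w in measure_pmf p. ?x w + ?y w = ?xy w"
    unfolding AE_measure_pmf_iff
  proof
    fix w assume w: "w \<in> set_pmf p"
    show "?x w + ?y w = ?xy w"
      using pmf_map_apply_pos[OF w, of X] pmf_map_apply_pos[OF w, of Y] assms(1)
      by (simp add: indep_var_pmf_map_pair[OF assms(2)] log_mult)
  qed
  have sum: "integrable (measure_pmf p) (\<lambda>w. ?x w + ?y w)"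
    using int by (rule Bochner_Integration.integrable_add)
  show "integrable (measure_pmf p) ?xy"
    using sum ae by (subst integrable_cong_AE[where g = "\<lambda>w. ?x w + ?y w"]) auto
  have "measure_pmf.expectation p ?xy = measure_pmf.expectation p (\<lambda>w. ?x w + ?y w)"
    using ae by (intro integral_cong_AE) auto
  also have "\<dots> = -2" using assms(3,4) unfolding entropy_pmf[OF assms(1)] by (simp add: int)
  finally show "measure_pmf.expectation p ?xy = -2" .
qed

lemma entropy_pmf_bij:
  fixes X :: "'a \<Rightarrow> 'b :: countable"
  assumes "1 < b"
    and "\<And>w w'. w \<in> set_pmf p \<Longrightarrow> w' \<in> set_pmf p \<Longrightarrow> X w = X w' \<longleftrightarrow> Y w = Y w'"
  shows "prob_space.entropy (measure_pmf p) b (count_space UNIV) X =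
    - measure_pmf.expectation p (\<lambda>w. log b (pmf (map_pmf Y p) (Y w)))"
proof -
  have "pmf (map_pmf X p) (X w) = pmf (map_pmf Y p) (Y w)" if w: "w \<in> set_pmf p" for w
    by (rule antisym; rule pmf_map_mono; use assms(2) w in blast)
  then show ?thesis
    unfolding entropy_pmf[OF assms(1)]
    by (intro arg_cong[of _ _ uminus] integral_cong_AE) (auto simp: AE_measure_pmf_iff)
qed

section \<open>A bottleneck rules out a solution\<close>

context two_pair_unicast_network
begin

text \<open>An arc that \<open>B\<close> separates from both sources is a function of its in-arcs,
  each of which is in \<open>B\<close> or again separated by \<open>B\<close>.\<close>

lemma network_code_determined:
  assumes code: "network_code G S c b \<Omega> M f X"
    and agree: "\<And>e. e \<in> B \<Longrightarrow> X e \<omega> = X e \<omega>'"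
    and "e \<in> arcs G" "e \<in> B \<or> (\<forall>k\<in>{1, 2}. \<not> avoiding_reachable B (s k) (tail G e))"
  shows "X e \<omega> = X e \<omega>'"
  using assms(3,4)
proof (induction e rule: line_induct)
  case (step e)
  show ?case
  proof (cases "e \<in> B")
    case False
    then have unreach: "\<not> avoiding_reachable B (s k) (tail G e)" if "k \<in> {1, 2}" for k
      using step.prems that by blast
    have "e \<noteq> S k" if "k \<in> {1, 2}" for k
      using unreach[OF that] S_arc(2)[OF that] by auto
    then have e: "e \<in> arcs G - {S 1, S 2}" using step.hyps by blast
    have "X e' \<omega> = X e' \<omega>'" if e': "e' \<in> in_arcs G (tail G e)" for e'
    proof (rule step.IH)
      show arc: "e' \<in> arcs G" "head G e' = tail G e" using e' by auto
      show "e' \<in> B \<or> (\<forall>k\<in>{1, 2}. \<not> avoiding_reachable B (s k) (tail G e'))"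
        using unreach avoiding_reachable_step[of B _ e'] arc by metis
    qed
    then have "restrict (\<lambda>e'. X e' \<omega>) (in_arcs G (tail G e)) =
        restrict (\<lambda>e'. X e' \<omega>') (in_arcs G (tail G e))"
      by (rule restrict_ext)
    moreover have "X e v = f e (restrict (\<lambda>e'. X e' v) (in_arcs G (tail G e)))" for v
      using code e unfolding network_code_def by blast
    ultimately show ?thesis by metis
  qed (rule agree)
qed

lemma reachable_avoiding_own_S:
  assumes "i \<in> {1, 2}" "S i \<in> B" "avoiding_reachable B (s i) v"
  shows "v = s i"
  using assms(3)
proof (induction rule: avoiding_reachable_induct)
  case (step e)
  then show ?case using S_unique[OF assms(1), of e] assms(2) by blast
qed simp

lemma tail_T_neq_s: "i \<in> {1, 2} \<Longrightarrow> k \<in> {1, 2} \<Longrightarrow> tail G (T i) \<noteq> s k"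
  using no_direct_arc T_arc by blast

lemma not_available_if_bottleneck:
  assumes ij: "i \<in> {1, 2}" "j \<in> {1, 2}" "i \<noteq> j"
    and "e \<in> arcs G" "c e \<le> 1"
    and cut: "\<not> avoiding_reachable {e} (s i) (t i)" "\<not> avoiding_reachable {e} (s j) (t j)"
      "\<not> avoiding_reachable {e} (s i) (t j)"
  shows "\<not> available G S T c"
proof
  assume "available G S T c"
  then obtain b \<Omega> M f X where "network_coding_solution G S T c b \<Omega> M f X"
    by (auto simp: available_def)
  then have code: "network_code G S c b \<Omega> M f X"
    and cond: "\<And>k. k \<in> {1, 2} \<Longrightarrow> prob_space.conditional_entropy (measure_pmf \<Omega>) b
      (count_space UNIV) (count_space UNIV) (X (S k)) (X (T k)) = 0"
    by (auto simp: network_coding_solution_def)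
  from code have b: "1 < b"
    and indep: "prob_space.indep_var (measure_pmf \<Omega>) (count_space UNIV) (M 1) (count_space UNIV) (M 2)"
    and H: "prob_space.entropy (measure_pmf \<Omega>) b (count_space UNIV) (M 1) = 1"
      "prob_space.entropy (measure_pmf \<Omega>) b (count_space UNIV) (M 2) = 1"
    and XS: "\<And>k. k \<in> {1, 2} \<Longrightarrow> X (S k) = M k"
    and He: "prob_space.entropy (measure_pmf \<Omega>) b (count_space UNIV) (X e) \<le> real (c e)"
    using \<open>e \<in> arcs G\<close> unfolding network_code_def by blast+
  let ?M = "\<lambda>w. (M 1 w, M 2 w)"
  note M_int = indep_pair_log_pmf(1)[OF b indep H]

  \<comment> \<open>Only \<open>S k\<close> leaves \<open>s k\<close>, so the two source arcs
    together separate the sources from every other arc.\<close>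
  have from_messages: "X a w = X a w'" if "a \<in> arcs G" "?M w = ?M w'" for a w w'
  proof (rule network_code_determined[OF code, of "{S 1, S 2}"])
    show "X a' w = X a' w'" if "a' \<in> {S 1, S 2}" for a'
      using that XS[of 1] XS[of 2] \<open>?M w = ?M w'\<close> by auto
    have "a \<in> {S 1, S 2}" if "k \<in> {1, 2}" "avoiding_reachable {S 1, S 2} (s k) (tail G a)" for k
      using reachable_avoiding_own_S[OF that(1) _ that(2)] S_unique[OF that(1) \<open>a \<in> arcs G\<close>] that(1) by blast
    then show "a \<in> {S 1, S 2} \<or> (\<forall>k\<in>{1, 2}. \<not> avoiding_reachable {S 1, S 2} (s k) (tail G a))" by blast
  qed (rule that(1))

  have decode: "M k w = M k w'"
    if k: "k \<in> {1, 2}" and w: "w \<in> set_pmf \<Omega>" "w' \<in> set_pmf \<Omega>" "X (T k) w = X (T k) w'" for k w w'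
  proof -
    let ?Z = "\<lambda>w. (X (S k) w, X (T k) w)"
    \<comment> \<open>The pair \<open>?Z\<close> is a function of the messages and thus inherits
      integrability from them, which ensures that the zero conditional entropy is genuine.\<close>
    have "pmf (map_pmf ?M \<Omega>) (?M v) \<le> pmf (map_pmf ?Z \<Omega>) (?Z v)" for v
      by (rule pmf_map_mono) (use from_messages S_arc(1)[OF k] T_arc(1)[OF k] in blast)
    then have "integrable (measure_pmf \<Omega>) (\<lambda>v. log b (pmf (map_pmf ?Z \<Omega>) (?Z v)))"
      by (intro integrable_log_pmf_coarsening[OF b M_int]) (simp add: pmf_le_1)
    then have "X (S k) w = X (S k) w'"
      by (rule conditional_entropy_zero_determines[OF b cond[OF k] _ w])
    then show ?thesis unfolding XS[OF k] .
  qed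

  have to_messages: "?M w = ?M w'"
    if w: "w \<in> set_pmf \<Omega>" "w' \<in> set_pmf \<Omega>" "X e w = X e w'" for w w'
  proof -
    have dj: "T j \<in> {e} \<or> (\<forall>k\<in>{1, 2}. \<not> avoiding_reachable {e} (s k) (tail G (T j)))"
    proof (rule iffD1[OF disj_commute disjCI], rule ballI, rule notI)
      fix k assume "k \<in> {1, 2}" "T j \<notin> {e}" "avoiding_reachable {e} (s k) (tail G (T j))"
      then have "avoiding_reachable {e} (s k) (t j)" "k = i \<or> k = j"
        using avoiding_reachable_step T_arc[OF ij(2)] ij by (metis, auto)
      then show False using cut by blast
    qed
    have "X (T j) w = X (T j) w'"
      by (rule network_code_determined[OF code _ T_arc(1)[OF ij(2)] dj]) (use w(3) in blast)
    then have Mj: "M j w = M j w'" by (rule decode[OF ij(2) w(1,2)])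
    \<comment> \<open>After message \<open>j\<close> is decoded, the value on \<open>S j\<close> is
      known too. So \<open>e\<close> has to block only \<open>s i\<close>, and \<open>S j\<close>
      blocks \<open>s j\<close>, which has no direct arc to \<open>t i\<close>.\<close>
    have di: "T i \<in> {e, S j} \<or> (\<forall>k\<in>{1, 2}. \<not> avoiding_reachable {e, S j} (s k) (tail G (T i)))"
    proof (rule iffD1[OF disj_commute disjCI], rule ballI, rule notI)
      fix k assume k: "k \<in> {1, 2}" "T i \<notin> {e, S j}" "avoiding_reachable {e, S j} (s k) (tail G (T i))"
      then consider "k = i" | "k = j" using ij by auto
      then show False
      proof cases
        case 1
        have "avoiding_reachable {e, S j} (s i) (t i)"
          using k 1 avoiding_reachable_step T_arc[OF ij(1)] by metis
        then show False using cut(1) avoiding_reachable_mono[of "{e, S j}" _ _ "{e}"] by blast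
      next
        case 2
        then show False
          using reachable_avoiding_own_S[OF ij(2), of "{e, S j}"] k tail_T_neq_s[OF ij(1,2)] by blast
      qed
    qed
    have "X (T i) w = X (T i) w'"
      by (rule network_code_determined[OF code _ T_arc(1)[OF ij(1)] di])
        (use w(3) Mj XS[OF ij(2)] in auto)
    then have "M i w = M i w'" by (rule decode[OF ij(1) w(1,2)])
    then show ?thesis using Mj ij by auto
  qed

  have "prob_space.entropy (measure_pmf \<Omega>) b (count_space UNIV) (X e) =
      - measure_pmf.expectation \<Omega> (\<lambda>w. log b (pmf (map_pmf ?M \<Omega>) (?M w)))"
    by (rule entropy_pmf_bij[OF b]) (use to_messages from_messages[OF \<open>e \<in> arcs G\<close>] in blast)
  also have "\<dots> = 2" using indep_pair_log_pmf(2)[OF b indep H] by simp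
  finally show False using He \<open>c e \<le> 1\<close> by linarith
qed

section \<open>Deciding availability\<close>

lemma reachable_between_terminals:
  assumes "i \<in> {1, 2}" "S i \<notin> B" "T i \<notin> B"
    and "avoiding_reachable B (head G (S i)) (tail G (T i))"
  shows "avoiding_reachable B (s i) (t i)"
proof -
  have "avoiding_reachable B (s i) (head G (S i))"
    using avoiding_reachable_arc[OF S_arc(1)[OF assms(1)] assms(2)] S_arc(2)[OF assms(1)] by simp
  moreover have "avoiding_reachable B (tail G (T i)) (t i)"
    using avoiding_reachable_arc[OF T_arc(1)[OF assms(1)] assms(3)] T_arc(2)[OF assms(1)] by simp
  ultimately show ?thesis using assms(4) avoiding_reachable_trans by metis
qed

lemma reachable_if_capacity_pos:
  assumes "i \<in> {1, 2}" "1 \<le> c (S i)"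
  shows "avoiding_reachable {} (s i) (t i)"
proof -
  obtain P where P: "card P = c (S i)" "\<forall>p\<in>P. apath (head G (S i)) p (tail G (T i))"
    using max_edge_disjoint_paths_witness capacity_source[OF assms(1)] by metis
  then have "P \<noteq> {}" using assms(2) by auto
  then obtain p where "apath (head G (S i)) p (tail G (T i))" using P(2) by blast
  then show ?thesis
    using awalk_avoiding_reachable[of _ p _ "{}"] assms(1)
    by (intro reachable_between_terminals) (auto simp: apath_def)
qed

text \<open>Of two edge-disjoint paths between the original terminals, at least one avoids
  \<open>e\<close>.\<close>

lemma bottleneck_of_wide_pair:
  assumes "i \<in> {1, 2}" "2 \<le> c (S i)" "\<not> avoiding_reachable {e} (s i) (t i)"
  shows "e \<in> {S i, T i}"
proof (rule ccontr)
  assume e: "e \<notin> {S i, T i}"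
  obtain P where P: "card P = c (S i)" "\<forall>p\<in>P. apath (head G (S i)) p (tail G (T i))"
    "\<forall>p\<in>P. \<forall>q\<in>P. p \<noteq> q \<longrightarrow> set p \<inter> set q = {}"
    using max_edge_disjoint_paths_witness capacity_source[OF assms(1)] by metis
  obtain p q where pq: "p \<in> P" "q \<in> P" "p \<noteq> q"
    using P(1) assms(2) card_le_Suc0_iff_eq[of P] by (cases "finite P") auto
  then have "e \<notin> set p \<or> e \<notin> set q" using P(3) by blast
  then obtain r where "r \<in> P" "e \<notin> set r" using pq by blast
  then have "avoiding_reachable {e} (head G (S i)) (tail G (T i))"
    using P(2) by (intro awalk_avoiding_reachable[of _ r]) (auto simp: apath_def)
  then have "avoiding_reachable {e} (s i) (t i)"
    using e by (intro reachable_between_terminals assms(1)) auto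
  then show False using assms(3) by blast
qed

text \<open>Only \<open>S i\<close> and \<open>T i\<close> can lie on all paths of a wide pair, and
  neither blocks the other pair.\<close>

lemma no_bottleneck_if_wide:
  assumes ij: "i \<in> {1, 2}" "j \<in> {1, 2}" "i \<noteq> j"
    and "2 \<le> c (S i)" "1 \<le> c (S j)"
    and "\<not> avoiding_reachable {e} (s i) (t i)"
  shows "avoiding_reachable {e} (s j) (t j)"
  using bottleneck_of_wide_pair[OF ij(1) assms(4,6)] reachable_if_capacity_pos[OF ij(2) assms(5)]
    reachable_avoiding_S[OF ij] reachable_avoiding_T[OF ij] by blast

section \<open>Minimum cuts and bottlenecks\<close>

lemma capacity_pos:
  assumes "1 \<le> c (S 1)" "1 \<le> c (S 2)" "e \<in> arcs G"
  shows "1 \<le> c e"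
proof (cases "e \<in> {S 1, S 2, T 1, T 2}")
  case True
  moreover have "c (T i) = c (S i)" if "i \<in> {1, 2}" for i
    using capacity_source[OF that] capacity_sink[OF that] by simp
  ultimately show ?thesis using assms by auto
next
  case False
  then show ?thesis using capacity_inner[of e] assms(3) by simp
qed

lemma min_cut_capacity_le_source:
  assumes "i \<in> {1, 2}" "j \<in> {1, 2}"
  shows "min_cut_capacity G c (s i) (t j) \<le> c (S i)"
proof -
  have "{e \<in> arcs G. tail G e = s i \<and> head G e \<noteq> s i} = {S i}"
    using S_unique[OF assms(1)] S_arc[OF assms(1)] head_neq_s[OF assms(1)] by blast
  then have "{S i} \<in> cuts G (s i) (t j)"
    using cut_of_vertex[OF s_in_verts[OF assms(1)] s_neq_t[OF assms]] by metis
  then show ?thesis using min_cut_capacity_le[of _ "s i" "t j" c] by fastforce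
qed

text \<open>A solution carries entropy 1 over \<open>S i\<close>, so \<open>c (S i)\<close> is
  positive and a path joins the pair. A cut of capacity 0 could then contain only terminal arcs of
  the other pair, which that path does not use.\<close>

lemma not_available_if_min_cut_zero:
  assumes i: "i \<in> {1, 2}" and zero: "min_cut_capacity G c (s i) (t i) = 0"
  shows "\<not> available G S T c"
proof
  assume "available G S T c"
  then obtain b \<Omega> M f X where code: "network_code G S c b \<Omega> M f X"
    by (auto simp: available_def network_coding_solution_def)
  have "X (S i) = M i" "prob_space.entropy (measure_pmf \<Omega>) b (count_space UNIV) (M i) = 1"
    "prob_space.entropy (measure_pmf \<Omega>) b (count_space UNIV) (X (S i)) \<le> real (c (S i))"
    using code i S_arc(1)[OF i] unfolding network_code_def by blast+
  then have pos: "1 \<le> c (S i)" by simp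
  define j where "j = 3 - i"
  have j: "j \<in> {1, 2}" "j \<noteq> i" using i by (auto simp: j_def)
  have all: "k \<in> {1, 2} \<Longrightarrow> k = i \<or> k = j" for k using i by (auto simp: j_def)
  obtain K where K: "K \<in> cuts G (s i) (t i)" "sum c K = 0"
    using min_cut_exists[OF s_in_verts[OF i] s_neq_t[OF i i], of c] zero by metis
  have K0: "c e = 0" if "e \<in> K" for e using K that finite_cut[OF K(1)] by auto
  have "K \<subseteq> {T j, S j}"
  proof
    fix e assume e: "e \<in> K"
    then have "e \<in> arcs G" using K(1) by (auto simp: cuts_def)
    then have "e \<in> {S 1, S 2, T 1, T 2}" using capacity_inner[of e] K0[OF e] by (cases "e \<in> {S 1, S 2, T 1, T 2}") auto
    then have "\<exists>k\<in>{1, 2}. e = S k \<or> e = T k" by auto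
    moreover have "c (T i) = c (S i)" using capacity_source[OF i] capacity_sink[OF i] by simp
    then have "e \<noteq> S i" "e \<noteq> T i" using K0[OF e] pos by auto
    ultimately show "e \<in> {T j, S j}" using all by blast
  qed
  moreover have "avoiding_reachable {T j, S j} (s i) (t i)"
    using reachable_avoiding_T[OF j(1) i j(2)] reachable_avoiding_S[OF j(1) i j(2)]
      reachable_if_capacity_pos[OF i pos] by blast
  ultimately have "avoiding_reachable K (s i) (t i)" using avoiding_reachable_mono by blast
  then show False using cut_not_avoidable[OF K(1)] by blast
qed

lemma available_if_no_bottleneck:
  assumes "1 \<le> c (S 1)" "1 \<le> c (S 2)"
    and "\<And>e. \<not> avoiding_reachable {e} (s 1) (t 1) \<Longrightarrow>
      \<not> avoiding_reachable {e} (s 2) (t 2) \<Longrightarrow>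
      avoiding_reachable {e} (s 1) (t 2) \<and> avoiding_reachable {e} (s 2) (t 1)"
  shows "available G S T c"
proof -
  have "avoiding_reachable {} (s i) (t i)" if "i \<in> {1, 2}" for i
    using reachable_if_capacity_pos[OF that] assms(1,2) that by auto
  then obtain K where "valid_labelling K" using valid_labelling_exists assms(3) by metis
  then show ?thesis using available_if_valid_labelling capacity_pos[OF assms(1,2)] by blast
qed

text \<open>A path from \<open>s i\<close> to \<open>t j\<close> avoiding \<open>e\<close> would
  meet some other \<open>a\<close> in \<open>A\<close>. From \<open>a\<close> one can continue to
  \<open>t i\<close>, and this continuation must use \<open>e\<close>; so \<open>a\<close> precedes
  \<open>e\<close>, against the choice of \<open>e\<close> as a first arc of
  \<open>A\<close>.\<close>

lemma first_common_arc_is_bottleneck: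
  assumes A: "e \<in> A" "A \<subseteq> arcs G" "\<And>a. a \<in> A \<Longrightarrow> (a, e) \<notin> line_rel\<^sup>+"
    and reach: "avoiding_reachable {} (s i) (t i)"
    and cut: "\<And>a. a \<in> A \<Longrightarrow> \<not> avoiding_reachable {a} (s i) (t i)"
    and unreach: "\<not> avoiding_reachable A (s i) (t j)"
  shows "\<not> avoiding_reachable {e} (s i) (t j)"
proof
  assume e: "avoiding_reachable {e} (s i) (t j)"
  have "\<not> avoiding_reachable ({e} \<union> A) (s i) (t j)"
    using unreach A(1) by (simp add: insert_absorb)
  with e obtain a where a: "a \<in> A" "a \<in> arcs G" "a \<notin> {e}" "avoiding_reachable {e} (s i) (tail G a)"
    by (rule avoiding_reachable_hits_tail)
  have "avoiding_reachable {e} (s i) (head G a)"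
    using a(4,2,3) by (rule avoiding_reachable_step)
  then have "\<not> avoiding_reachable {e} (head G a) (t i)"
    using cut[OF A(1)] avoiding_reachable_trans by metis
  moreover have "avoiding_reachable {} (head G a) (t i)"
    using avoiding_reachable_hits_head[OF reach] cut[OF a(1)] by simp
  ultimately obtain e' where "e' \<in> {e}" "avoiding_reachable {} (head G a) (tail G e')"
    using avoiding_reachable_hits_tail[of "{}" "head G a" "t i" "{e}"] by auto
  then have "(a, e) \<in> line_rel\<^sup>+"
    using avoiding_reachable_line_rel[OF _ a(2)] A(1,2) by blast
  then show False using A(3)[OF a(1)] by blast
qed

lemma not_available_if_crossing_cut:
  assumes ij: "i \<in> {1, 2}" "j \<in> {1, 2}" "i \<noteq> j"
    and one: "min_cut_capacity G c (s i) (t i) = 1" "min_cut_capacity G c (s j) (t j) = 1"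
    and A: "A = cut_arcs G c (s i) (t i) \<inter> cut_arcs G c (s j) (t j)" "A \<noteq> {}"
    and zero: "min_cut_capacity (del_arcs G A) c (s i) (t j) = 0"
  shows "\<not> available G S T c"
proof -
  have "1 \<le> c (S i)" "1 \<le> c (S j)"
    using min_cut_capacity_le_source[OF ij(1,1)] min_cut_capacity_le_source[OF ij(2,2)] one by auto
  then have S_pos: "1 \<le> c (S 1)" "1 \<le> c (S 2)" using ij by auto
  note pos = capacity_pos[OF S_pos]
  note cut_i = cut_arcs_unavoidable[OF _ one(1) pos] and cut_j = cut_arcs_unavoidable[OF _ one(2) pos]
  obtain a where "a \<in> A" using A(2) by blast
  \<comment> \<open>A first arc of \<open>A\<close> in topological order, by well-foundedness of the
    line graph.\<close>
  then obtain e where e: "e \<in> A" "\<And>a. (a, e) \<in> line_rel\<^sup>+ \<Longrightarrow> a \<notin> A"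
    using wfE_min[OF wf_trancl[OF wf_line]] by metis
  interpret del: fin_digraph "del_arcs G A" by (rule fin_digraph_del_arcs)
  have "\<not> del.avoiding_reachable {} (s i) (t j)"
    by (rule del.min_cut_capacity_zero_unreachable[OF zero])
      (use s_in_verts[OF ij(1)] s_neq_t[OF ij(1,2)] pos in \<open>auto simp: del_arcs_def\<close>)
  then have "\<not> avoiding_reachable A (s i) (t j)"
    unfolding avoiding_reachable_del_arcs by simp
  moreover have "avoiding_reachable {} (s i) (t i)"
    by (rule min_cut_capacity_pos_reachable[where c = c, OF _ s_in_verts[OF ij(1)]]) (use one(1) in simp)
  ultimately have "\<not> avoiding_reachable {e} (s i) (t j)"
    by (intro first_common_arc_is_bottleneck[OF e(1)])
      (use e(2) cut_i A(1) in blast)+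
  then show ?thesis
    using cut_i[of e] cut_j[of e] e(1) A(1)
    by (intro not_available_if_bottleneck[OF ij, of e]) auto
qed

text \<open>An arc on all paths of both pairs is no terminal arc, so it has capacity 1 and belongs
  to \<open>A\<close>; the crossing paths that avoid \<open>A\<close> avoid it too. If
  \<open>A\<close> is empty, there is no such arc.\<close>

lemma available_if_common_arcs_avoidable:
  assumes one: "min_cut_capacity G c (s 1) (t 1) = 1" "min_cut_capacity G c (s 2) (t 2) = 1"
    and A: "A = cut_arcs G c (s 1) (t 1) \<inter> cut_arcs G c (s 2) (t 2)"
    and cross: "A \<noteq> {} \<Longrightarrow> avoiding_reachable A (s 1) (t 2) \<and> avoiding_reachable A (s 2) (t 1)"
  shows "available G S T c"
proof -
  have S_pos: "1 \<le> c (S 1)" "1 \<le> c (S 2)"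
    using min_cut_capacity_le_source[of 1 1] min_cut_capacity_le_source[of 2 2] one by auto
  show ?thesis
  proof (rule available_if_no_bottleneck[OF S_pos])
    fix e assume e: "\<not> avoiding_reachable {e} (s 1) (t 1)" "\<not> avoiding_reachable {e} (s 2) (t 2)"
    show "avoiding_reachable {e} (s 1) (t 2) \<and> avoiding_reachable {e} (s 2) (t 1)"
    proof -
      have reach: "avoiding_reachable {} (s 1) (t 1)" "avoiding_reachable {} (s 2) (t 2)"
        using reachable_if_capacity_pos[of 1] reachable_if_capacity_pos[of 2] S_pos by auto
      obtain a where "a \<in> {e}" "a \<in> arcs G"
        using avoiding_reachable_hits_tail[OF reach(1), of "{e}"] e(1) by auto
      moreover have "e \<notin> {S 1, T 1}"
        using e(2) reachable_avoiding_S[of 1 2, OF _ _ _ reach(2)]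
          reachable_avoiding_T[of 1 2, OF _ _ _ reach(2)] by auto
      moreover have "e \<notin> {S 2, T 2}"
        using e(1) reachable_avoiding_S[of 2 1, OF _ _ _ reach(1)]
          reachable_avoiding_T[of 2 1, OF _ _ _ reach(1)] by auto
      ultimately have "c e = 1" using capacity_inner[of e] by auto
      then have "e \<in> A"
        unfolding A
        using unavoidable_arc_in_cut_arcs[OF e(1) s_in_verts[of 1] one(1)]
          unavoidable_arc_in_cut_arcs[OF e(2) s_in_verts[of 2] one(2)] by simp
      then show ?thesis
        using cross avoiding_reachable_mono[of A _ _ "{e}"] by blast
    qed
  qed
qed

end


theorem mainTheorem3:
  fixes G :: "('v, 'e) pre_digraph"
    and s t :: "nat \<Rightarrow> 'v" and S T :: "nat \<Rightarrow> 'e" and c :: "'e \<Rightarrow> nat"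
  assumes "two_pair_unicast_network G s t S T c"
  shows
    "(min_cut_capacity G c (s 1) (t 1) * min_cut_capacity G c (s 2) (t 2) = 0
        \<longrightarrow> \<not> available G S T c) \<and>
     (min_cut_capacity G c (s 1) (t 1) * min_cut_capacity G c (s 2) (t 2) > 1
        \<longrightarrow> available G S T c) \<and>
     (min_cut_capacity G c (s 1) (t 1) * min_cut_capacity G c (s 2) (t 2) = 1 \<and>
      cut_arcs G c (s 1) (t 1) \<inter> cut_arcs G c (s 2) (t 2) = {}
        \<longrightarrow> available G S T c) \<and>
     (\<forall>A G'.
        min_cut_capacity G c (s 1) (t 1) * min_cut_capacity G c (s 2) (t 2) = 1 \<and>
        A = cut_arcs G c (s 1) (t 1) \<inter> cut_arcs G c (s 2) (t 2) \<and> A \<noteq> {} \<and>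
        G' = del_arcs G A
        \<longrightarrow>
        (min_cut_capacity G' c (s 1) (t 2) * min_cut_capacity G' c (s 2) (t 1) = 0
           \<longrightarrow> \<not> available G S T c) \<and>
        (min_cut_capacity G' c (s 1) (t 2) * min_cut_capacity G' c (s 2) (t 1) \<noteq> 0
           \<longrightarrow> available G S T c))"
proof -
  interpret two_pair_unicast_network G s t S T c by (rule assms)
  let ?C1 = "min_cut_capacity G c (s 1) (t 1)" and ?C2 = "min_cut_capacity G c (s 2) (t 2)"
  have le: "?C1 \<le> c (S 1)" "?C2 \<le> c (S 2)"
    using min_cut_capacity_le_source[of 1 1] min_cut_capacity_le_source[of 2 2] by auto
  show ?thesis
  proof (intro conjI allI impI; (elim conjE)?)
    assume "?C1 * ?C2 = 0"
    then show "\<not> available G S T c"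
      using not_available_if_min_cut_zero[of 1] not_available_if_min_cut_zero[of 2] by auto
  next
    assume gt: "1 < ?C1 * ?C2"
    then have "?C1 \<noteq> 0" "?C2 \<noteq> 0" by (intro notI, simp)+
    then have pos: "1 \<le> c (S 1)" "1 \<le> c (S 2)" using le by linarith+
    \<comment> \<open>Both factors are positive and not both 1, so one of the pairs is wide.\<close>
    have "\<not> (?C1 = 1 \<and> ?C2 = 1)" using gt by auto
    then have "2 \<le> c (S 1) \<or> 2 \<le> c (S 2)" using le \<open>?C1 \<noteq> 0\<close> \<open>?C2 \<noteq> 0\<close> by linarith
    then have "avoiding_reachable {e} (s 2) (t 2)" if "\<not> avoiding_reachable {e} (s 1) (t 1)" for e
      using no_bottleneck_if_wide[of 1 2 e] no_bottleneck_if_wide[of 2 1 e] pos that by auto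
    then show "available G S T c" using available_if_no_bottleneck[OF pos] by blast
  next
    assume "?C1 * ?C2 = 1" "cut_arcs G c (s 1) (t 1) \<inter> cut_arcs G c (s 2) (t 2) = {}"
    then show "available G S T c"
      by (intro available_if_common_arcs_avoidable) auto
  next
    fix A G' assume one: "?C1 * ?C2 = 1" and A: "A = cut_arcs G c (s 1) (t 1) \<inter> cut_arcs G c (s 2) (t 2)"
      "A \<noteq> {}" and G': "G' = del_arcs G A"
      and zero: "min_cut_capacity G' c (s 1) (t 2) * min_cut_capacity G' c (s 2) (t 1) = 0"
    have C: "?C1 = 1" "?C2 = 1" using one by auto
    from zero consider "min_cut_capacity (del_arcs G A) c (s 1) (t 2) = 0"
      | "min_cut_capacity (del_arcs G A) c (s 2) (t 1) = 0" unfolding G' by auto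
    then show "\<not> available G S T c"
    proof cases
      case 1
      then show ?thesis using not_available_if_crossing_cut[of 1 2 A] C A by simp
    next
      case 2
      then show ?thesis using not_available_if_crossing_cut[of 2 1 A] C A by (simp add: Int_commute)
    qed
  next
    fix A G' assume one: "?C1 * ?C2 = 1" and A: "A = cut_arcs G c (s 1) (t 1) \<inter> cut_arcs G c (s 2) (t 2)"
      "A \<noteq> {}" and G': "G' = del_arcs G A"
      and nz: "min_cut_capacity G' c (s 1) (t 2) * min_cut_capacity G' c (s 2) (t 1) \<noteq> 0"
    interpret del: fin_digraph "del_arcs G A" by (rule fin_digraph_del_arcs)
    \<comment> \<open>A nonzero cut capacity after deleting \<open>A\<close> yields a path in the
      original network that avoids \<open>A\<close>.\<close>
    have "avoiding_reachable A (s i) (t j)"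
      if "i \<in> {1, 2}" "min_cut_capacity G' c (s i) (t j) \<noteq> 0" for i j
      using del.min_cut_capacity_pos_reachable[of c "s i" "t j"] that s_in_verts[OF that(1)]
      unfolding G' avoiding_reachable_del_arcs by (simp add: del_arcs_def)
    then have "avoiding_reachable A (s 1) (t 2) \<and> avoiding_reachable A (s 2) (t 1)" using nz by auto
    then show "available G S T c"
      using one by (intro available_if_common_arcs_avoidable[OF _ _ A(1)]) auto
  qed
qed

end
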